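(* Suppose $u$ is a continuous complex-valued function in the quarter-plane $\mathbb{R}_{\ge0}\times\mathbb{R}_{\le0}$ which solves the Klein-Gordon equation $u''_{xy}+u=0$ in the sense of distribution theory in the interior quarter-plane $\mathbb{R}_{>0}\times\mathbb{R}_{<0}$. Suppose moreover that $u$ vanishes along the semi-axis $\{0\}\times\mathbb{R}_{\le0}$. Finally, assume that $u$ meets the uniform growth bound $$|u(x,y)|=\mathrm{O}\Big(\exp\big(\theta_1\sqrt{|x|}+\exp(\theta_2\sqrt{|y|})\big)\Big),\qquad (x,y)\in\mathbb{R}_{\ge0}\times\mathbb{R}_{\le0},$$ where the parameters $\theta_1,\theta_2\in\mathbb{R}_{>0}$ satisfy $\theta_1\theta_2<2\pi$. It then follows that $u=0$ on all of $\mathbb{R}_{\ge0}\times\mathbb{R}_{\le0}$.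
   Context: Here $u''_{xy}=\partial_x\partial_y u$. The uniform growth bound means that there is a constant $C$, independent of $(x,y)$, such that $|u(x,y)|\le C\exp\big(\theta_1\sqrt{|x|}+\exp(\theta_2\sqrt{|y|})\big)$ on the indicated set. *)

theory Defs
  imports "HOL-Analysis.Analysis"
begin

definition dir_deriv ::
    "'a::real_normed_vector \<Rightarrow> ('a \<Rightarrow> 'b::real_normed_vector) \<Rightarrow> 'a \<Rightarrow> 'b" where
  "dir_deriv v f p = frechet_derivative f (at p) v"

primrec Ck :: "nat \<Rightarrow> ('a::real_normed_vector \<Rightarrow> 'b::real_normed_vector) \<Rightarrow> bool" where
  "Ck 0 f \<longleftrightarrow> continuous_on UNIV f"
| "Ck (Suc k) f \<longleftrightarrow> (\<forall>p. f differentiable at p) \<and> (\<forall>v. Ck k (dir_deriv v f))"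

definition test_function :: "'a::real_normed_vector set \<Rightarrow> ('a \<Rightarrow> complex) \<Rightarrow> bool" where
  "test_function \<Omega> \<phi> \<longleftrightarrow>
     (\<forall>k. Ck k \<phi>) \<and> compact (closure {p. \<phi> p \<noteq> 0}) \<and> closure {p. \<phi> p \<noteq> 0} \<subseteq> \<Omega>"

(* The functional on test functions given by integration against u. It is meaningful only for u
   locally integrable on the open set \<Omega>, e.g. continuous there: the Bochner integral of a
   non-integrable function is 0. *)
definition distr_of ::
    "'a::euclidean_space set \<Rightarrow> ('a \<Rightarrow> complex) \<Rightarrow> ('a \<Rightarrow> complex) \<Rightarrow> complex" where
  "distr_of \<Omega> u \<phi> = (LINT p:\<Omega>|lborel. u p * \<phi> p)"

definition distr_deriv :: "'a::real_normed_vector \<Rightarrow>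
    (('a \<Rightarrow> complex) \<Rightarrow> complex) \<Rightarrow> ('a \<Rightarrow> complex) \<Rightarrow> complex" where
  "distr_deriv v T \<phi> = - T (dir_deriv v \<phi>)"

(* \<partial>\<^sub>x \<partial>\<^sub>y u + u = 0 as an identity of distributions on \<Omega>;
   the directions (1, 0) and (0, 1) are those of x and y. *)
definition klein_gordon_distr :: "(real \<times> real) set \<Rightarrow> (real \<times> real \<Rightarrow> complex) \<Rightarrow> bool" where
  "klein_gordon_distr \<Omega> u \<longleftrightarrow>
     (\<forall>\<phi>. test_function \<Omega> \<phi> \<longrightarrow>
        distr_deriv (1, 0) (distr_deriv (0, 1) (distr_of \<Omega> u)) \<phi> + distr_of \<Omega> u \<phi> = 0)"

end

(* With v(x,t) = u(x,-t) the equation becomes v_xt = v with v(0,t) = 0. The Laplace transform F_t of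
   v(.,t) in x then satisfies F_t(s) = exp(t/s) F_0(s) for Re s > 0, and the growth bound gives, with
   w = 1/s and any kappa > theta1^2/4,
     |F_0(1/w)| <= const * exp(- t Re w + exp(theta2 sqrt t) + kappa |w|^2 / Re w)   for every t >= 0.
   Taking sqrt t = ln(Re w) / theta2 shows that G(w) = F_0(1/w) is bounded on the region
   |Im w| < c (Re w) ln(Re w) for any c < 2/(theta1 theta2), and that on the positive axis it decays
   like exp(- const * w (ln w)^2). The map z |-> z / (ln z)^beta sends the right half-plane near
   infinity into this region when 2/(pi beta) < c, and the pulled back function decays faster than
   every exponential on the positive axis as soon as beta < 2; both are possible precisely because
   theta1 theta2 < 2 pi. By Phragmen-Lindelof the pullback vanishes, hence F_0 = 0, all F_t = 0
   and v = 0. *)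
theory Submission
  imports Defs "HOL-Complex_Analysis.Complex_Analysis" "HOL-Real_Asymp.Real_Asymp"
begin

text \<open>Data are prescribed on one characteristic only: the values v(x,0) are free, and the task
  is to show that the growth bound leaves them no choice but 0, that is, F_0 = 0. The factor
  exp(t/s) appears because v_xt = v turns into s * dF_t/dt = F_t, the edge x = 0 contributing
  nothing. For w = 1/s its modulus is exp(t Re w), and F_0 has to pay for it at every t at once. The
  term \<kappa> |w|^2 / Re w equals \<kappa> / Re s; the supremum of
  \<open>\<theta>\<^sub>1 * sqrt x - x * Re s\<close> over x is
  \<open>\<theta>\<^sub>1\<^sup>2 / (4 * Re s)\<close>, and the surplus in \<kappa> pays for the
  integration over x. The chosen t makes exp(\<open>\<theta>\<^sub>2 * sqrt t\<close>) equal to Re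
  w, so the exponent is Re w times 1 + \<kappa> (|w| / Re w)^2 - (ln (Re w))^2 /
  \<open>\<theta>\<^sub>2\<^sup>2\<close>; the region is where the bracket is negative for large w.
  The obstacle is a trade-off. Larger \<beta> pushes the image of the imaginary axis deeper into the
  region, where |w| / Re w is about 2 ln|z| / (pi \<beta>). But on the positive axis w is about x /
  (ln x)^\<beta>, so the decay exponent shrinks to order x (ln x)^(2 - \<beta>).\<close>

section \<open>Smooth cutoff functions\<close>

lemma dir_deriv_eq: "(f has_derivative f') (at p) \<Longrightarrow> dir_deriv v f p = f' v"
  by (simp add: dir_deriv_def frechet_derivative_at[symmetric])

lemma Ck_0:
  assumes "Ck k f" shows "continuous_on UNIV f"
proof (cases k)
  case (Suc j)
  with assms have "continuous (at p) f" for p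
    by (auto intro: differentiable_imp_continuous_within)
  then show ?thesis by (simp add: continuous_at_imp_continuous_on)
qed (use assms in auto)

lemma Ck_Suc: "Ck (Suc k) f \<Longrightarrow> Ck k f"
proof (induction k arbitrary: f)
  case 0
  then show ?case using Ck_0[of "Suc 0" f] by simp
qed auto

lemma Ck_add:
  assumes "Ck k f" "Ck k g" shows "Ck k (\<lambda>p. f p + g p)"
  using assms
proof (induction k arbitrary: f g)
  case 0
  then show ?case by (auto intro!: continuous_intros)
next
  case (Suc k)
  have "dir_deriv v (\<lambda>p. f p + g p) = (\<lambda>p. dir_deriv v f p + dir_deriv v g p)" for v
  proof
    fix p
    have "((\<lambda>p. f p + g p) has_derivative
        (\<lambda>v. frechet_derivative f (at p) v + frechet_derivative g (at p) v)) (at p)"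
      using Suc.prems by (auto intro!: derivative_intros simp: frechet_derivative_works[symmetric])
    then show "dir_deriv v (\<lambda>p. f p + g p) p = dir_deriv v f p + dir_deriv v g p"
      by (subst dir_deriv_eq) (auto simp: dir_deriv_def)
  qed
  with Suc show ?case by auto
qed

lemma Ck_bounded_linear:
  assumes "bounded_linear L" "Ck k f" shows "Ck k (\<lambda>p. L (f p))"
  using assms(2)
proof (induction k arbitrary: f)
  case 0
  then show ?case by (auto intro!: bounded_linear.continuous_on[OF assms(1)])
next
  case (Suc k)
  have D: "((\<lambda>p. L (f p)) has_derivative (\<lambda>v. L (frechet_derivative f (at p) v))) (at p)" for p
    using Suc.prems
    by (auto intro!: bounded_linear.has_derivative[OF assms(1)] simp: frechet_derivative_works[symmetric])
  have "dir_deriv v (\<lambda>p. L (f p)) = (\<lambda>p. L (dir_deriv v f p))" for v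
    using dir_deriv_eq[OF D] by (auto simp: dir_deriv_def)
  with Suc D show ?case by (auto simp: differentiable_def)
qed

lemma Ck_affine:
  assumes "bounded_linear L" "Ck k f" shows "Ck k (\<lambda>p. f (L p + c))"
  using assms(2)
proof (induction k arbitrary: f)
  case 0
  have "continuous_on UNIV (\<lambda>p. L p + c)"
    by (intro continuous_intros bounded_linear.continuous_on[OF assms(1)])
  with 0 show ?case using continuous_on_compose2[of UNIV f UNIV] by auto
next
  case (Suc k)
  have D: "((\<lambda>p. f (L p + c)) has_derivative (\<lambda>v. frechet_derivative f (at (L p + c)) (L v))) (at p)" for p
  proof (rule has_derivative_compose[of "\<lambda>p. L p + c" L _ _ f])
    show "((\<lambda>p. L p + c) has_derivative L) (at p)"
      using bounded_linear.has_derivative[OF assms(1) has_derivative_ident] 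
      by (auto intro!: derivative_eq_intros)
    show "(f has_derivative frechet_derivative f (at (L p + c))) (at (L p + c))"
      using Suc.prems by (auto simp: frechet_derivative_works[symmetric])
  qed
  have "dir_deriv v (\<lambda>p. f (L p + c)) = (\<lambda>p. dir_deriv (L v) f (L p + c))" for v
    using dir_deriv_eq[OF D] by (auto simp: dir_deriv_def)
  with Suc D show ?case by (auto simp: differentiable_def)
qed

lemma Ck_mult:
  fixes f g :: "'a::real_normed_vector \<Rightarrow> 'b::real_normed_algebra"
  assumes "Ck k f" "Ck k g" shows "Ck k (\<lambda>p. f p * g p)"
  using assms
proof (induction k arbitrary: f g)
  case 0
  then show ?case by (auto intro!: continuous_intros)
next
  case (Suc k)
  have D: "((\<lambda>p. f p * g p) has_derivative
        (\<lambda>v. f p * frechet_derivative g (at p) v + frechet_derivative f (at p) v * g p)) (at p)" for p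
    using Suc.prems by (auto intro!: has_derivative_mult simp: frechet_derivative_works[symmetric])
  have "dir_deriv v (\<lambda>p. f p * g p) = (\<lambda>p. f p * dir_deriv v g p + dir_deriv v f p * g p)" for v
    using dir_deriv_eq[OF D] by (auto simp: dir_deriv_def)
  moreover have "Ck k (\<lambda>p. f p * dir_deriv v g p + dir_deriv v f p * g p)" for v
    using Suc.prems Ck_Suc[of k f] Ck_Suc[of k g] by (intro Ck_add Suc.IH) auto
  ultimately show ?case using D by (auto simp: differentiable_def)
qed

text \<open>On the line every directional derivative is a multiple of the ordinary one, so a single
  function \<open>f'\<close> carries the induction over the order.\<close>

lemma Ck_real_Suc:
  fixes f :: "real \<Rightarrow> 'b::real_normed_vector"
  assumes D: "\<And>x. (f has_vector_derivative f' x) (at x)" and "Ck k f'"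
  shows "Ck (Suc k) f"
proof -
  have "dir_deriv v f = (\<lambda>x. v *\<^sub>R f' x)" for v
    using dir_deriv_eq[OF D[unfolded has_vector_derivative_def]] by auto
  moreover have "Ck k (\<lambda>x. v *\<^sub>R f' x)" for v
    using Ck_bounded_linear[OF bounded_linear_scaleR_right assms(2)] .
  ultimately show ?thesis
    using D by (auto simp: differentiable_def has_vector_derivative_def)
qed

section \<open>Flat functions and a smooth step\<close>

text \<open>The polynomial factor makes the family generated by the flat function exp(-1/x) closed
  under differentiation, so smoothness follows by induction over the order with \<open>P\<close>
  arbitrary.\<close>

definition poly_exp_inverse :: "real poly \<Rightarrow> real \<Rightarrow> real" where
  "poly_exp_inverse P x = (if x > 0 then poly P (1 / x) * exp (- (1 / x)) else 0)"

lemma poly_div_exp_tendsto_0: "((\<lambda>x. poly P x / exp x) \<longlongrightarrow> (0::real)) at_top"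
proof -
  have "((\<lambda>x. \<Sum>i\<le>degree P. coeff P i * (x ^ i / exp x)) \<longlongrightarrow> (\<Sum>i\<le>degree P. coeff P i * 0)) at_top"
    by (intro tendsto_intros tendsto_power_div_exp_0)
  then show ?thesis by (simp add: poly_altdef sum_divide_distrib)
qed

text \<open>With y = 1/x, the derivative of P(y) exp(-y) in y is (P' - P)(y) exp(-y), and dy/dx =
  -y^2.\<close>

lemma poly_exp_inverse_has_derivative:
  "(poly_exp_inverse P has_real_derivative
     poly_exp_inverse ([:0, 0, 1:] * (P - pderiv P)) x) (at x)"
proof -
  consider "x > 0" | "x < 0" | "x = 0" by linarith
  then show ?thesis
  proof cases
    case 1
    have "((\<lambda>x. poly P (1 / x) * exp (- (1 / x))) has_real_derivative
        poly_exp_inverse ([:0, 0, 1:] * (P - pderiv P)) x) (at x)"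
      using 1 by (auto intro!: derivative_eq_intros poly_DERIV[THEN DERIV_chain2]
          simp: poly_exp_inverse_def field_simps power2_eq_square)
    then show ?thesis
      by (rule has_field_derivative_transform_within_open[of _ _ _ "{0<..}"])
        (use 1 in \<open>auto simp: poly_exp_inverse_def\<close>)
  next
    case 2
    have "((\<lambda>x. 0) has_real_derivative poly_exp_inverse ([:0, 0, 1:] * (P - pderiv P)) x) (at x)"
      using 2 by (simp add: poly_exp_inverse_def)
    then show ?thesis
      by (rule has_field_derivative_transform_within_open[of _ _ _ "{..<0}"])
        (use 2 in \<open>auto simp: poly_exp_inverse_def\<close>)
  next
    case 3
    \<comment> \<open>The difference quotient at 0 from the right is y P(y) exp(-y) with y = 1/h;
      \<open>pCons 0 P\<close> supplies the factor y.\<close>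
    have "((\<lambda>h. poly (pCons 0 P) (inverse h) / exp (inverse h)) \<longlongrightarrow> 0) (at_right 0)"
      by (rule filterlim_compose[OF poly_div_exp_tendsto_0 filterlim_inverse_at_top_right])
    then have "((\<lambda>h. poly_exp_inverse P h / h) \<longlongrightarrow> 0) (at_right 0)"
      by (rule Lim_transform_eventually)
        (auto simp: eventually_at_filter poly_exp_inverse_def exp_minus field_simps)
    moreover have "((\<lambda>h. 0) \<longlongrightarrow> (0::real)) (at_left 0)" by simp
    then have "((\<lambda>h. poly_exp_inverse P h / h) \<longlongrightarrow> 0) (at_left 0)"
      by (rule Lim_transform_eventually)
        (auto simp: eventually_at_filter poly_exp_inverse_def)
    ultimately have "((\<lambda>h. poly_exp_inverse P h / h) \<longlongrightarrow> 0) (at 0)"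
      by (rule filterlim_split_at_real[rotated])
    then show ?thesis
      using 3 by (simp add: DERIV_def poly_exp_inverse_def)
  qed
qed

lemma Ck_poly_exp_inverse: "Ck k (poly_exp_inverse P)"
proof (induction k arbitrary: P)
  case 0
  show ?case
    by (auto intro!: continuous_at_imp_continuous_on DERIV_isCont[OF poly_exp_inverse_has_derivative])
next
  case (Suc k)
  show ?case
    by (rule Ck_real_Suc[OF poly_exp_inverse_has_derivative[THEN has_real_derivative_iff_has_vector_derivative[THEN iffD1]] Suc])
qed

text \<open>\<open>S\<close> is the normalised antiderivative of a bump supported in [0,1]. The
  derivative is exported too: nonnegative and of mass 1, it becomes the mollifier, while
  \<open>S\<close> becomes the smoothed indicator.\<close>

lemma smooth_step:
  obtains S S' :: "real \<Rightarrow> real" where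
    "\<And>k. Ck k S" "\<And>x. (S has_real_derivative S' x) (at x)" "continuous_on UNIV S'"
    "\<And>x. S' x \<ge> 0" "\<And>x. x \<notin> {0..1} \<Longrightarrow> S' x = 0"
    "\<And>x. x \<le> 0 \<Longrightarrow> S x = 0" "\<And>x. x \<ge> 1 \<Longrightarrow> S x = 1" "\<And>x. 0 \<le> S x" "\<And>x. S x \<le> 1"
proof -
  define h where "h x = poly_exp_inverse 1 x * poly_exp_inverse 1 (1 - x)" for x
  have Ck_h: "Ck k h" for k
    using Ck_mult[OF Ck_poly_exp_inverse[of k 1]
        Ck_affine[OF bounded_linear_minus[OF bounded_linear_ident] Ck_poly_exp_inverse[of k 1], of 1]]
    by (simp add: h_def[abs_def] algebra_simps)
  have cont: "continuous_on UNIV h" using Ck_0[OF Ck_h] .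
  have nonneg: "h x \<ge> 0" for x by (simp add: h_def poly_exp_inverse_def)
  have zero: "h x = 0" if "x \<notin> {0<..<1}" for x
    using that by (auto simp: h_def poly_exp_inverse_def)
  have pos: "h x > 0" if "x \<in> {0<..<1}" for x
    using that by (auto simp: h_def poly_exp_inverse_def)
  obtain H where H: "\<And>x. (H has_real_derivative h x) (at x)"
    using einterval_antiderivative[of "-\<infinity>" "\<infinity>" h] cont
    by (auto simp: has_real_derivative_iff_has_vector_derivative continuous_on_eq_continuous_at)
  have mono: "H x \<le> H y" if "x \<le> y" for x y
    by (rule DERIV_nonneg_imp_nondecreasing[OF that]) (use H nonneg in blast)
  have left: "H x = H 0" if "x \<le> 0" for x
  proof (rule antisym)
    show "H 0 \<le> H x"
      by (rule DERIV_nonpos_imp_nonincreasing[OF that]) (use H zero in \<open>auto intro!: exI\<close>)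
  qed (use that mono in auto)
  have right: "H x = H 1" if "x \<ge> 1" for x
  proof (rule antisym)
    show "H x \<le> H 1"
      by (rule DERIV_nonpos_imp_nonincreasing[OF that]) (use H zero in \<open>auto intro!: exI\<close>)
  qed (use that mono in auto)
  have lt: "H 0 < H 1"
    by (rule DERIV_pos_imp_increasing_open)
      (use H pos in \<open>auto intro!: continuous_at_imp_continuous_on DERIV_isCont[OF H]\<close>)
  define c where "c = H 1 - H 0"
  have c: "c > 0" using lt by (simp add: c_def)
  define S where "S x = (H x - H 0) / c" for x
  define S' where "S' x = h x / c" for x
  have D: "(S has_real_derivative S' x) (at x)" for x
    unfolding S_def S'_def using DERIV_cdivide[OF DERIV_diff[OF H[of x] DERIV_const[of "H 0"]], of c] by simp
  have Ck_S': "Ck k S'" for k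
    using Ck_bounded_linear[OF bounded_linear_divide Ck_h] by (simp add: S'_def[abs_def])
  have Ck_S: "Ck k S" for k
    by (rule Ck_Suc, rule Ck_real_Suc[OF D[THEN has_real_derivative_iff_has_vector_derivative[THEN iffD1]] Ck_S'])
  have b: "H 0 \<le> H x" "H x \<le> H 1" for x
    using mono[of 0 x] left[of x] mono[of x 1] right[of x] by (cases "x \<le> 0"; cases "x \<le> 1"; force)+
  show thesis
  proof (rule that[of S S'])
    show "continuous_on UNIV S'" using Ck_0[OF Ck_S'] .
    show "S' x = 0" if "x \<notin> {0..1}" for x
    proof -
      have "h x = 0" by (rule zero) (use that in auto)
      then show ?thesis by (simp add: S'_def)
    qed
    show "S' x \<ge> 0" for x using nonneg[of x] c by (simp add: S'_def)
    show "S x = 0" if "x \<le> 0" for x using left[OF that] by (simp add: S_def)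
    show "S x = 1" if "x \<ge> 1" for x using right[OF that] c by (simp add: S_def c_def)
    show "0 \<le> S x" "S x \<le> 1" for x using b[of x] c by (auto simp: S_def c_def)
  qed (rule Ck_S D)+
qed

section \<open>From the distributional equation to an integral equation\<close>

text \<open>Passes from the Lebesgue integral defining \<open>distr_of\<close> to a gauge integral
  over one fixed box, where Fubini and the limit arguments take place.\<close>

lemma lebesgue_integral_eq_integral_cbox:
  fixes f :: "'a::euclidean_space \<Rightarrow> complex"
  assumes "continuous_on (cbox a b) f" "\<And>p. p \<notin> \<Omega> \<inter> cbox a b \<Longrightarrow> f p = 0"
  shows "(LINT p:\<Omega>|lborel. f p) = integral (cbox a b) f"
proof -
  have "set_integrable lborel (cbox a b) f"
    unfolding set_integrable_def by (rule borel_integrable_compact[OF compact_cbox assms(1)])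
  then have "(LINT p:cbox a b|lborel. f p) = integral (cbox a b) f"
    by (rule set_borel_integral_eq_integral)
  moreover have "(LINT p:\<Omega>|lborel. f p) = (LINT p:cbox a b|lborel. f p)"
    unfolding set_lebesgue_integral_def using assms(2)
    by (intro Bochner_Integration.integral_cong) (auto simp: indicator_def)
  ultimately show ?thesis by simp
qed

text \<open>For a test function A(x) B(y) the two minus signs of the distributional derivatives
  cancel and the mixed derivative is A'(x) B'(y). The box reaches the axes, although the support
  stays away from them, so that one box serves cutoffs whose supports approach the axes.\<close>

lemma klein_gordon_tensor_test:
  fixes A A' B B' :: "real \<Rightarrow> real"
  assumes cont: "continuous_on ({0..} \<times> {..0}) u"
    and kg: "klein_gordon_distr ({0<..} \<times> {..<0}) u"
    and A: "\<And>k. Ck k A" "\<And>x. (A has_real_derivative A' x) (at x)" "continuous_on UNIV A'"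
    and B: "\<And>k. Ck k B" "\<And>x. (B has_real_derivative B' x) (at x)" "continuous_on UNIV B'"
    and supp: "\<And>x. x \<notin> {c..d} \<Longrightarrow> A x = 0 \<and> A' x = 0"
      "\<And>y. y \<notin> {e..f} \<Longrightarrow> B y = 0 \<and> B' y = 0"
    and "c > 0" "f < 0"
  shows "integral (cbox (0, e) (d, 0)) (\<lambda>p. u p * of_real (A (fst p) * B (snd p)))
    + integral (cbox (0, e) (d, 0)) (\<lambda>p. u p * of_real (A' (fst p) * B' (snd p))) = 0"
proof -
  let ?\<Omega> = "{0<..} \<times> {..<0} :: (real \<times> real) set"
  define \<phi> where "\<phi> p = complex_of_real (A (fst p) * B (snd p))" for p
  have "Ck k \<phi>" for k
    unfolding \<phi>_def
    using Ck_affine[OF bounded_linear_fst A(1)[of k], of 0] Ck_affine[OF bounded_linear_snd B(1)[of k], of 0]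
    by (intro Ck_bounded_linear[OF bounded_linear_of_real] Ck_mult) auto
  moreover have K: "closure {p. \<phi> p \<noteq> 0} \<subseteq> cbox (c, e) (d, f)"
  proof (rule closure_minimal[OF _ closed_cbox], rule subsetI)
    fix p assume "p \<in> {p. \<phi> p \<noteq> 0}"
    then have "fst p \<in> {c..d}" "snd p \<in> {e..f}"
      using supp by (fastforce simp: \<phi>_def)+
    then show "p \<in> cbox (c, e) (d, f)" by (cases p) (auto simp: cbox_Pair_eq)
  qed
  then have "compact (closure {p. \<phi> p \<noteq> 0})"
    using compact_Int_closed[OF compact_cbox closed_closure, of "(c, e)" "(d, f)" "{p. \<phi> p \<noteq> 0}"]
    by (simp only: inf_absorb2)
  moreover have "cbox (c, e) (d, f) \<subseteq> ?\<Omega>"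
    using \<open>c > 0\<close> \<open>f < 0\<close> by (auto simp: cbox_Pair_eq)
  with K have "closure {p. \<phi> p \<noteq> 0} \<subseteq> ?\<Omega>" by blast
  ultimately have "test_function ?\<Omega> \<phi>" by (simp add: test_function_def)
  then have weak: "distr_of ?\<Omega> u (dir_deriv (0, 1) (dir_deriv (1, 0) \<phi>)) + distr_of ?\<Omega> u \<phi> = 0"
    using kg unfolding klein_gordon_distr_def distr_deriv_def by auto
  have "(\<phi> has_derivative (\<lambda>v. of_real (fst v * A' (fst p) * B (snd p) + A (fst p) * (snd v * B' (snd p))))) (at p)" for p
    unfolding \<phi>_def
    by (auto intro!: derivative_eq_intros has_derivative_of_real A(2)[THEN DERIV_compose_FDERIV]
        B(2)[THEN DERIV_compose_FDERIV] simp: algebra_simps)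
  from dir_deriv_eq[OF this]
  have D1: "dir_deriv (1, 0) \<phi> = (\<lambda>p. of_real (A' (fst p) * B (snd p)))" by auto
  have D2: "dir_deriv (0, 1) (\<lambda>p. complex_of_real (A' (fst p) * B (snd p))) p =
      of_real (A' (fst p) * B' (snd p))" for p
  proof -
    \<comment> \<open>Differentiating A'(x) B(y) as a function on the plane requires A' to be
      differentiable, which \<open>Ck 2\<close> provides.\<close>
    have "dir_deriv 1 A = A'"
      using dir_deriv_eq[OF A(2)[unfolded has_field_derivative_def]] by auto
    with A(1)[of 2] have "A' differentiable at x" for x
      by (auto simp: numeral_2_eq_2)
    then obtain A'' where A'': "(A' has_real_derivative A'' x) (at x)" for x
      by (metis real_differentiable_def)
    have "((\<lambda>p. complex_of_real (A' (fst p) * B (snd p))) has_derivative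
        (\<lambda>v. of_real (fst v * A'' (fst p) * B (snd p) + A' (fst p) * (snd v * B' (snd p))))) (at p)"
      by (auto intro!: derivative_eq_intros has_derivative_of_real A''[THEN DERIV_compose_FDERIV]
          B(2)[THEN DERIV_compose_FDERIV] simp: algebra_simps)
    from dir_deriv_eq[OF this] show ?thesis by simp
  qed
  have cu: "continuous_on (cbox (0, e) (d, 0)) u"
    by (rule continuous_on_subset[OF cont]) (auto simp: cbox_Pair_eq)
  have cA: "continuous_on UNIV A" "continuous_on UNIV B" using A(1) B(1) Ck_0 by blast+
  have I: "distr_of ?\<Omega> u (\<lambda>p. of_real (F (fst p) * G (snd p))) =
      integral (cbox (0, e) (d, 0)) (\<lambda>p. u p * of_real (F (fst p) * G (snd p)))"
    if FG: "continuous_on UNIV F" "continuous_on UNIV G" "\<And>x. x \<notin> {c..d} \<Longrightarrow> F x = 0"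
       "\<And>y. y \<notin> {e..f} \<Longrightarrow> G y = 0" for F G
    unfolding distr_of_def
  proof (rule lebesgue_integral_eq_integral_cbox)
    show "continuous_on (cbox (0, e) (d, 0)) (\<lambda>p. u p * of_real (F (fst p) * G (snd p)))"
      by (intro continuous_intros cu continuous_on_compose2[OF FG(1)] continuous_on_compose2[OF FG(2)]) auto
    show "u p * of_real (F (fst p) * G (snd p)) = 0"
      if p: "p \<notin> ?\<Omega> \<inter> cbox (0, e) (d, 0)" for p
    proof (cases "fst p \<in> {c..d} \<and> snd p \<in> {e..f}")
      case True
      with p \<open>c > 0\<close> \<open>f < 0\<close> show ?thesis by (cases p) (auto simp: cbox_Pair_eq)
    next
      case False
      with FG(3,4) show ?thesis by auto
    qed
  qed
  have "dir_deriv (0, 1) (dir_deriv (1, 0) \<phi>) = (\<lambda>p. of_real (A' (fst p) * B' (snd p)))"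
    unfolding D1 using D2 by (rule ext)
  moreover have "\<phi> = (\<lambda>p. of_real (A (fst p) * B (snd p)))" by (simp add: \<phi>_def[abs_def])
  moreover have "distr_of ?\<Omega> u (\<lambda>p. of_real (A (fst p) * B (snd p))) =
      integral (cbox (0, e) (d, 0)) (\<lambda>p. u p * of_real (A (fst p) * B (snd p)))"
    by (rule I[OF cA]) (use supp in blast)+
  moreover have "distr_of ?\<Omega> u (\<lambda>p. of_real (A' (fst p) * B' (snd p))) =
      integral (cbox (0, e) (d, 0)) (\<lambda>p. u p * of_real (A' (fst p) * B' (snd p)))"
    by (rule I[OF A(3) B(3)]) (use supp in blast)+
  ultimately show ?thesis
    using weak by (simp only: add.commute)
qed

text \<open>The mass is counted inside the box only, so \<open>p\<close> may lie on its boundary.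
  This is what allows evaluation at corners on the axes, with kernels leaning into the
  quadrant.\<close>

lemma approximate_identity:
  fixes f :: "'a::euclidean_space \<Rightarrow> complex" and w :: "nat \<Rightarrow> 'a \<Rightarrow> real"
  assumes f: "continuous_on (cbox a b) f" and p: "p \<in> cbox a b"
    and w: "\<And>n. continuous_on (cbox a b) (w n)" "\<And>n q. w n q \<ge> 0"
    and mass: "eventually (\<lambda>n. integral (cbox a b) (w n) = 1) sequentially"
    and supp: "\<And>r. r > 0 \<Longrightarrow> eventually (\<lambda>n. \<forall>q. w n q \<noteq> 0 \<longrightarrow> dist q p < r) sequentially"
  shows "(\<lambda>n. integral (cbox a b) (\<lambda>q. f q * of_real (w n q))) \<longlonglongrightarrow> f p"
proof (rule tendstoI)
  fix e :: real assume "e > 0"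
  then obtain r where r: "r > 0" "\<And>q. q \<in> cbox a b \<Longrightarrow> dist q p < r \<Longrightarrow> norm (f q - f p) < e / 2"
    using f p unfolding continuous_on_iff dist_norm by (metis half_gt_zero)
  show "\<forall>\<^sub>F n in sequentially. dist (integral (cbox a b) (\<lambda>q. f q * of_real (w n q))) (f p) < e"
    using mass supp[OF r(1)]
  proof eventually_elim
    case (elim n)
    have int: "(\<lambda>q. f q * of_real (w n q)) integrable_on cbox a b"
      "(\<lambda>q. f p * of_real (w n q)) integrable_on cbox a b" "w n integrable_on cbox a b"
      by (intro integrable_continuous continuous_intros f w)+
    have fp: "integral (cbox a b) (\<lambda>q. f p * of_real (w n q)) = f p"
      using elim integral_linear[OF int(3) bounded_linear_of_real[where 'a = complex]] by (simp add: o_def)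
    have "norm (integral (cbox a b) (\<lambda>q. f q * of_real (w n q)) - f p) =
        norm (integral (cbox a b) (\<lambda>q. f q * of_real (w n q) - f p * of_real (w n q)))"
      unfolding Henstock_Kurzweil_Integration.integral_diff[OF int(1,2)] fp ..
    also have "\<dots> \<le> integral (cbox a b) (\<lambda>q. e / 2 * w n q)"
    proof (rule integral_norm_bound_integral)
      fix q assume q: "q \<in> cbox a b"
      show "norm (f q * of_real (w n q) - f p * of_real (w n q)) \<le> e / 2 * w n q"
      proof (cases "w n q = 0")
        case False
        with elim r(2)[OF q] have "norm (f q - f p) \<le> e / 2" by force
        then have "norm (f q - f p) * w n q \<le> e / 2 * w n q" by (rule mult_right_mono) (rule w)
        then show ?thesis using w(2)[of n q] by (simp add: norm_mult flip: left_diff_distrib)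
      qed auto
    qed (intro integrable_continuous continuous_intros f w)+
    also have "\<dots> = e / 2" using elim by simp
    finally show ?case using \<open>e > 0\<close> by (simp add: dist_norm)
  qed
qed


text \<open>The equation is tested against a product of smoothed indicators of the sides. The
  product tends to the indicator of the rectangle; the derivative of each factor is a difference of
  mollifiers at the two ends, so the mixed derivative tends to signed point masses at the four
  corners.\<close>

lemma klein_gordon_rectangle:
  assumes cont: "continuous_on ({0..} \<times> {..0}) u"
    and kg: "klein_gordon_distr ({0<..} \<times> {..<0}) u"
    and "X > 0" "T > 0"
  shows "u (X, -T) - u (0, -T) - u (X, 0) + u (0, 0) = integral (cbox (0, -T) (X, 0)) u"
proof -
  obtain S S' :: "real \<Rightarrow> real" where Ck_S: "\<And>k. Ck k S"
    and S_deriv: "\<And>x. (S has_real_derivative S' x) (at x)"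
    and cont_S': "continuous_on UNIV S'"
    and S'_nonneg: "\<And>x. S' x \<ge> 0" and S'_zero: "\<And>x. x \<notin> {0..1} \<Longrightarrow> S' x = 0"
    and S_left: "\<And>x. x \<le> 0 \<Longrightarrow> S x = 0" and S_right: "\<And>x. x \<ge> 1 \<Longrightarrow> S x = 1"
    and S_bounds: "\<And>x. 0 \<le> S x" "\<And>x. S x \<le> 1"
    using smooth_step by blast
  define N where "N n = real (Suc n)" for n
  have N: "N n \<ge> 1" "N n > 0" for n by (auto simp: N_def)
  have N_lim: "filterlim N at_top sequentially"
    unfolding N_def by (rule filterlim_compose[OF filterlim_real_sequentially filterlim_Suc])
  (* The shift by -1 keeps the supports inside the open quadrant although the limiting
     rectangle has sides on its boundary. *)
  define s where "s n a x = S (N n * (x - a) - 1)" for n a x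
  define r where "r n a x = N n * S' (N n * (x - a) - 1)" for n a x
  have s_deriv: "(s n a has_real_derivative r n a x) (at x)" for n a x
    unfolding s_def r_def
    by (rule DERIV_chain2[OF S_deriv, THEN DERIV_cong]) (auto intro!: derivative_eq_intros)
  have Ck_s: "Ck k (s n a)" for k n a
    using Ck_affine[OF bounded_linear_mult_right[of "N n"] Ck_S[of k], of "- N n * a - 1"]
    by (simp add: s_def[abs_def] algebra_simps)
  have cont_r: "continuous_on UNIV (r n a)" for n a
    unfolding r_def by (intro continuous_intros continuous_on_compose2[OF cont_S']) auto
  have cont_s: "continuous_on UNIV (s n a)" for n a using Ck_0[OF Ck_s] .
  have r_nonneg: "r n a x \<ge> 0" for n a x
    unfolding r_def by (rule mult_nonneg_nonneg[OF less_imp_le[OF N(2)] S'_nonneg])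
  have r_zero: "r n a x = 0" if "x \<notin> {a + 1 / N n..a + 2 / N n}" for n a x
    using that N(2)[of n] by (auto simp: r_def field_simps intro!: S'_zero)
  have s_left: "s n a x = 0" if "x \<le> a + 1 / N n" for n a x
    using that N(2)[of n] by (auto simp: s_def field_simps intro!: S_left)
  have s_right: "s n a x = 1" if "x \<ge> a + 2 / N n" for n a x
    using that N(2)[of n] by (auto simp: s_def field_simps intro!: S_right)
  have N_inv: "2 / N n \<le> 2" "1 / N n > 0" for n using N[of n] by (auto simp: field_simps)
  \<comment> \<open>The shifted step vanishes at its own jump point, so the limits are indicators of
    half-open intervals.\<close>
  have step_lim: "(\<lambda>n. s n a x) \<longlonglongrightarrow> (if a < x then 1 else 0)" for a x
  proof (cases "a < x")
    case True
    have "eventually (\<lambda>n. N n > 2 / (x - a)) sequentially"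
      using N_lim by (simp add: filterlim_at_top_dense)
    then have "eventually (\<lambda>n. s n a x = 1) sequentially"
    proof eventually_elim
      case (elim n)
      with True N(2)[of n] show ?case by (intro s_right) (simp add: field_simps)
    qed
    with True show ?thesis by (simp add: tendsto_eventually)
  next
    case False
    then have "s n a x = 0" for n using N_inv(2)[of n] by (intro s_left) linarith
    with False show ?thesis by simp
  qed
  \<comment> \<open>The ramps lie to the right of their base points by at most
    \<open>2 / N n\<close>, which is at most 2; enlarging the rectangle by 2 accommodates all of
    them.\<close>
  let ?K = "cbox (0, - T - 2) (X + 2, 0)"
  have cu: "continuous_on ?K u"
    by (rule continuous_on_subset[OF cont]) (auto simp: cbox_Pair_eq)

  have mass: "integral {c..d} (r n a) = 1" if "c \<le> a" "a + 2 \<le> d" for n a c d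
  proof -
    have "(r n a has_integral (s n a d - s n a c)) {c..d}"
      using that s_deriv
      by (intro fundamental_theorem_of_calculus)
        (auto simp: has_real_derivative_iff_has_vector_derivative intro: has_vector_derivative_at_within)
    moreover have "s n a d = 1" "s n a c = 0"
      using that N_inv[of n] by (intro s_left s_right; linarith)+
    ultimately show ?thesis by (simp add: integral_unique)
  qed
  have corner: "(\<lambda>n. integral ?K (\<lambda>p. u p * of_real (r n a (fst p) * r n b (- snd p)))) \<longlonglongrightarrow> u (a, - b)"
    if ab: "0 \<le> a" "a \<le> X" "0 \<le> b" "b \<le> T" for a b
  proof (rule approximate_identity[OF cu])
    show "(a, - b) \<in> ?K" using ab by (auto simp: cbox_Pair_eq)
    show c: "continuous_on ?K (\<lambda>p. r n a (fst p) * r n b (- snd p))" for n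
      by (intro continuous_intros continuous_on_compose2[OF cont_r]) auto
    show "r n a (fst p) * r n b (- snd p) \<ge> 0" for n p using r_nonneg by simp
    have "integral ?K (\<lambda>p. r n a (fst p) * r n b (- snd p)) = 1" for n
    proof -
      have "integral {- T - 2..0} (\<lambda>y. r n b (- y)) = 1"
        using Henstock_Kurzweil_Integration.integral_reflect_real[of "T + 2" 0 "r n b"] mass[of 0 b "T + 2" n] ab by simp
      moreover have "integral {0..X + 2} (r n a) = 1" using mass[of 0 a "X + 2" n] ab by simp
      ultimately show ?thesis by (subst integral_prod_continuous[OF c]) simp
    qed
    then show "\<forall>\<^sub>F n in sequentially. integral ?K (\<lambda>p. r n a (fst p) * r n b (- snd p)) = 1" by simp
    fix e :: real assume "e > 0"
    \<comment> \<open>Each of the two coordinates is off by at most \<open>2 / N n\<close>, hence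
      the constant 4.\<close>
    have "eventually (\<lambda>n. N n > 4 / e) sequentially"
      using N_lim by (simp add: filterlim_at_top_dense)
    then show "\<forall>\<^sub>F n in sequentially. \<forall>p. r n a (fst p) * r n b (- snd p) \<noteq> 0 \<longrightarrow> dist p (a, - b) < e"
    proof (eventually_elim, intro allI impI)
      fix n p assume n: "N n > 4 / e" and "r n a (fst p) * r n b (- snd p) \<noteq> 0"
      then have *: "fst p \<in> {a + 1 / N n..a + 2 / N n}" "- snd p \<in> {b + 1 / N n..b + 2 / N n}"
        using r_zero mult_eq_0_iff by metis+
      have "dist p (a, - b) \<le> \<bar>fst p - a\<bar> + \<bar>snd p - (- b)\<bar>"
        unfolding dist_norm by (cases p) (use norm_Pair_le in \<open>auto simp: norm_Pair intro: sqrt_sum_squares_le_sum_abs\<close>)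
      also have "\<dots> \<le> 2 / N n + 2 / N n"
        using * N_inv(2)[of n] by (intro add_mono) (auto simp: abs_le_iff)
      also have "\<dots> < e" using n N(2)[of n] \<open>e > 0\<close> by (simp add: field_simps)
      finally show "dist p (a, - b) < e" .
    qed
  qed

  define A where "A n x = s n 0 x - s n X x" for n x
  define B where "B n y = s n 0 (- y) - s n T (- y)" for n y
  define g where "g p = (if p \<in> {0<..X} \<times> {-T..<0} then u p else 0)" for p
  have lhs: "(\<lambda>n. integral ?K (\<lambda>p. u p * of_real (A n (fst p) * B n (snd p)))) \<longlonglongrightarrow> integral ?K g"
  proof (rule dominated_convergence(2))
    show "(\<lambda>p. u p * of_real (A n (fst p) * B n (snd p))) integrable_on ?K" for n
      unfolding A_def B_def
      by (intro integrable_continuous continuous_intros cu continuous_on_compose2[OF cont_s]) auto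
    show "(\<lambda>p. norm (u p)) integrable_on ?K"
      by (intro integrable_continuous continuous_intros cu)
    show "norm (u p * of_real (A n (fst p) * B n (snd p))) \<le> norm (u p)" for n p
    proof -
      have "\<bar>A n (fst p)\<bar> \<le> 1" "\<bar>B n (snd p)\<bar> \<le> 1"
        unfolding A_def B_def s_def using S_bounds by (smt (verit))+
      then have "\<bar>A n (fst p)\<bar> * \<bar>B n (snd p)\<bar> \<le> 1" by (simp add: mult_le_one)
      then show ?thesis by (simp add: norm_mult abs_mult mult_left_le)
    qed
    show "(\<lambda>n. u p * of_real (A n (fst p) * B n (snd p))) \<longlonglongrightarrow> g p" if "p \<in> ?K" for p
    proof -
      have "(\<lambda>n. u p * of_real (A n (fst p) * B n (snd p))) \<longlonglongrightarrow>
        u p * of_real (((if 0 < fst p then 1 else 0) - (if X < fst p then 1 else 0)) *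
                       ((if 0 < - snd p then 1 else 0) - (if T < - snd p then 1 else 0)))"
        unfolding A_def B_def by (intro tendsto_intros step_lim)
      also have "u p * of_real (((if 0 < fst p then 1 else 0) - (if X < fst p then 1 else 0)) *
                       ((if 0 < - snd p then 1 else 0) - (if T < - snd p then 1 else 0))) = g p"
        using that assms(3,4) by (cases p) (auto simp: g_def cbox_Pair_eq)
      finally show ?thesis .
    qed
  qed
  \<comment> \<open>\<open>g\<close> and the restriction of \<open>u\<close> to the closed rectangle
    differ only on the coordinate axes, a null set.\<close>
  have g: "integral ?K g = integral (cbox (0, -T) (X, 0)) u"
  proof -
    let ?Z = "{p. p \<bullet> (1, 0) = 0} \<union> {p::real \<times> real. p \<bullet> (0, 1) = 0}"
    have "negligible ?Z"
      by (intro negligible_Un negligible_standard_hyperplane) (auto simp: Basis_prod_def)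
    then have "integral ?K g = integral ?K (\<lambda>p. if p \<in> cbox (0, -T) (X, 0) then u p else 0)"
      by (rule integral_spike) (auto simp: g_def cbox_Pair_eq)
    also have "\<dots> = integral (cbox (0, -T) (X, 0)) u"
    proof -
      have "cbox (0, - T) (X, 0) \<inter> ?K = cbox (0, - T) (X, 0)" by (auto simp: cbox_Pair_eq)
      then show ?thesis by (simp only: integral_restrict_Int)
    qed
    finally show ?thesis .
  qed

  let ?I = "\<lambda>n a b. integral ?K (\<lambda>p. u p * of_real (r n a (fst p) * r n b (- snd p)))"
  \<comment> \<open>The reflection of the second variable gives the derivative of \<open>B n\<close>
    a minus sign; this is why the corner terms appear with a plus sign once moved to the
    right.\<close>
  have test: "integral ?K (\<lambda>p. u p * of_real (A n (fst p) * B n (snd p))) =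
      ?I n 0 0 - ?I n 0 T - ?I n X 0 + ?I n X T" for n
  proof -
    have BD: "(B n has_real_derivative - (r n 0 (- y) - r n T (- y))) (at y)" for y
      unfolding B_def
      by (auto intro!: derivative_eq_intros DERIV_chain2[OF s_deriv])
    have Ck_B: "Ck k (B n)" for k
      using Ck_add[OF Ck_affine[OF bounded_linear_minus[OF bounded_linear_ident] Ck_s[of k n 0], of 0]
          Ck_bounded_linear[OF bounded_linear_minus[OF bounded_linear_ident]
            Ck_affine[OF bounded_linear_minus[OF bounded_linear_ident] Ck_s[of k n T], of 0]]]
      by (simp add: B_def[abs_def])
    have Ck_A: "Ck k (A n)" for k
      using Ck_add[OF Ck_s[of k n 0] Ck_bounded_linear[OF bounded_linear_minus[OF bounded_linear_ident] Ck_s[of k n X]]]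
      by (simp add: A_def[abs_def])
    have supp: "s n 0 x - s n a x = 0 \<and> r n 0 x - r n a x = 0" if "x \<notin> {1 / N n..a + 2}" "a > 0" for a x
    proof -
      from that(1) consider "x < 1 / N n" | "x > a + 2" by fastforce
      then show ?thesis
      proof cases
        case 1
        with \<open>a > 0\<close> show ?thesis by (simp add: s_left r_zero)
      next
        case 2
        have "s n 0 x = 1" "s n a x = 1"
          by (rule s_right; use 2 N_inv[of n] \<open>a > 0\<close> in linarith)+
        moreover have "r n 0 x = 0" "r n a x = 0"
          by (rule r_zero; use 2 N_inv[of n] \<open>a > 0\<close> in auto)+
        ultimately show ?thesis by simp
      qed
    qed
    have suppA: "A n x = 0 \<and> r n 0 x - r n X x = 0" if "x \<notin> {1 / N n..X + 2}" for x
      unfolding A_def using supp[OF that \<open>X > 0\<close>] .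
    have suppB: "B n y = 0 \<and> - (r n 0 (- y) - r n T (- y)) = 0" if "y \<notin> {- T - 2..- (1 / N n)}" for y
      unfolding B_def using supp[of "- y" T] that \<open>T > 0\<close> by auto
    have int: "(\<lambda>p. u p * of_real (r n a (fst p) * r n b (- snd p))) integrable_on ?K" for a b
      by (intro integrable_continuous continuous_intros cu continuous_on_compose2[OF cont_r]) auto
    have "integral ?K (\<lambda>p. u p * of_real ((r n 0 (fst p) - r n X (fst p)) * - (r n 0 (- snd p) - r n T (- snd p)))) =
      integral ?K (\<lambda>p. - (u p * of_real (r n 0 (fst p) * r n 0 (- snd p)) - u p * of_real (r n 0 (fst p) * r n T (- snd p))
        - u p * of_real (r n X (fst p) * r n 0 (- snd p)) + u p * of_real (r n X (fst p) * r n T (- snd p))))"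
      by (simp add: algebra_simps)
    also have "\<dots> = - (?I n 0 0 - ?I n 0 T - ?I n X 0 + ?I n X T)"
      by (simp only: integral_neg Henstock_Kurzweil_Integration.integral_add
          Henstock_Kurzweil_Integration.integral_diff int integrable_diff integrable_add)
    finally have I: "integral ?K (\<lambda>p. u p * of_real ((r n 0 (fst p) - r n X (fst p)) * - (r n 0 (- snd p) - r n T (- snd p)))) =
      - (?I n 0 0 - ?I n 0 T - ?I n X 0 + ?I n X T)" .
    have "integral ?K (\<lambda>p. u p * of_real (A n (fst p) * B n (snd p)))
      + integral ?K (\<lambda>p. u p * of_real ((r n 0 (fst p) - r n X (fst p)) * - (r n 0 (- snd p) - r n T (- snd p)))) = 0"
    proof (rule klein_gordon_tensor_test[OF cont kg Ck_A _ _ Ck_B BD _ suppA suppB])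
      show "(A n has_real_derivative r n 0 x - r n X x) (at x)" for x
        unfolding A_def by (intro DERIV_diff s_deriv)
      show "continuous_on UNIV (\<lambda>x. r n 0 x - r n X x)" by (intro continuous_intros cont_r)
      show "continuous_on UNIV (\<lambda>y. - (r n 0 (- y) - r n T (- y)))"
        by (intro continuous_intros continuous_on_compose2[OF cont_r]) auto
      show "1 / N n > 0" "- (1 / N n) < 0" using N_inv[of n] by auto
    qed auto
    then show ?thesis unfolding I by (simp only: add_uminus_conv_diff right_minus_eq)
  qed
  have "(\<lambda>n. ?I n 0 0 - ?I n 0 T - ?I n X 0 + ?I n X T) \<longlonglongrightarrow>
      u (0, - 0) - u (0, - T) - u (X, - 0) + u (X, - T)"
    by (intro tendsto_intros corner) (use assms(3,4) in auto)
  with lhs have "integral ?K g = u (0, - 0) - u (0, - T) - u (X, - 0) + u (X, - T)"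
    unfolding test by (rule LIMSEQ_unique)
  with g show ?thesis by (simp add: algebra_simps)
qed

section \<open>Phragmen-Lindelof principles\<close>

text \<open>The scheme common to the next two principles. The damping factor \<open>q e\<close> has
  modulus at most 1, so it does not spoil the bound on the frontier, and it pushes the product below
  \<open>M\<close> far out. The maximum principle on a bounded piece of \<open>S\<close> then
  applies, and letting e tend to 0 removes the factor.\<close>

lemma Phragmen_Lindelof_multiplier:
  fixes f :: "complex \<Rightarrow> complex" and q :: "real \<Rightarrow> complex \<Rightarrow> complex"
  assumes S: "closed S" and f: "continuous_on S f" "f holomorphic_on interior S"
    and frontier: "\<And>z. z \<in> frontier S \<Longrightarrow> norm (f z) \<le> M"
    and q: "\<And>e. e > 0 \<Longrightarrow> continuous_on S (q e)" "\<And>e. e > 0 \<Longrightarrow> q e holomorphic_on interior S"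
      "\<And>e z. e > 0 \<Longrightarrow> z \<in> S \<Longrightarrow> norm (q e z) \<le> 1"
    and q_lim: "\<And>z. z \<in> S \<Longrightarrow> ((\<lambda>e. q e z) \<longlongrightarrow> 1) (at_right 0)"
    and growth: "\<And>e. e > 0 \<Longrightarrow> \<exists>R0. \<forall>z\<in>S. norm z \<ge> R0 \<longrightarrow> norm (f z * q e z) \<le> M"
    and z: "z \<in> S"
  shows "norm (f z) \<le> M"
proof -
  have *: "norm (f z * q e z) \<le> M" if e: "e > 0" for e
  proof -
    obtain R0 where R0: "\<And>z. z \<in> S \<Longrightarrow> norm z \<ge> R0 \<Longrightarrow> norm (f z * q e z) \<le> M"
      using growth[OF e] by blast
    define R where "R = max R0 (norm z)"
    have R: "R \<ge> R0" "z \<in> cball 0 R" by (auto simp: R_def)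
    let ?T = "S \<inter> cball 0 R"
    show ?thesis
    proof (rule maximum_modulus_frontier[of "\<lambda>z. f z * q e z" ?T])
      show "(\<lambda>z. f z * q e z) holomorphic_on interior ?T"
        by (intro holomorphic_intros holomorphic_on_subset[OF f(2)] holomorphic_on_subset[OF q(2)[OF e]])
          (auto intro: subsetD[OF interior_mono])
      have "closure ?T = ?T" using S by (simp add: closed_Int)
      then show "continuous_on (closure ?T) (\<lambda>z. f z * q e z)"
        by (auto intro!: continuous_intros continuous_on_subset[OF f(1)] continuous_on_subset[OF q(1)[OF e]])
      show "bounded ?T" by (meson bounded_cball bounded_subset inf_le2)
      show "z \<in> ?T" using z R by simp
      fix w assume "w \<in> frontier ?T"
      then have w: "w \<in> ?T" "w \<in> frontier S \<or> w \<in> sphere 0 R"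
        using S \<open>closure ?T = ?T\<close> by (auto simp: frontier_def interior_Int)
      show "norm (f w * q e w) \<le> M"
      proof (cases "w \<in> frontier S")
        case True
        have "norm (f w) * norm (q e w) \<le> norm (f w) * 1"
          using q(3)[OF e] w by (intro mult_left_mono) auto
        with frontier[OF True] show ?thesis by (simp add: norm_mult)
      next
        case False
        with w R R0 show ?thesis by auto
      qed
    qed
  qed
  have "((\<lambda>e. norm (f z * q e z)) \<longlongrightarrow> norm (f z * 1)) (at_right 0)"
    by (intro tendsto_intros q_lim z)
  then have "norm (f z * 1) \<le> M"
    by (rule tendsto_upperbound) (auto simp: eventually_at_filter *)
  then show ?thesis by simp
qed

text \<open>The rotation \<open>c\<close> turns the sector so that its bisector is the positive
  axis. In an opening of pi/2 the critical order is 2; growth of order 1 is damped by exp(-e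
  p^(3/2)), where 3/2 lies strictly between the two orders.\<close>

lemma Phragmen_Lindelof_quarter_plane:
  fixes f :: "complex \<Rightarrow> complex"
  assumes S: "closed S" "\<And>z. z \<in> S \<Longrightarrow> \<bar>Im (c * z)\<bar> \<le> Re (c * z)" and c: "norm c = 1"
    and f: "continuous_on S f" "f holomorphic_on interior S"
    and frontier: "\<And>z. z \<in> frontier S \<Longrightarrow> norm (f z) \<le> M"
    and growth: "\<And>z. z \<in> S \<Longrightarrow> norm (f z) \<le> B * exp (K * norm z)"
    and M: "M > 0" and z: "z \<in> S"
  shows "norm (f z) \<le> M"
proof -
  (* The shift by 1 keeps the argument of powr away from the branch point at 0. *)
  define g where "g z = (c * z + 1) powr (3 / 2)" for z
  have pos: "Re (c * z + 1) > 0" if "z \<in> S" for z using S(2)[OF that] by auto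
  then have nonpos: "c * z + 1 \<notin> \<real>\<^sub>\<le>\<^sub>0" if "z \<in> S" for z
    using that by (fastforce simp: complex_nonpos_Reals_iff)
  \<comment> \<open>Arguments are at most pi/4 in modulus, and the power 3/2 takes them to at most 3
    pi/8, below pi/2.\<close>
  define k where "k = cos (3 * pi / 8)"
  have k: "k > 0" unfolding k_def by (rule cos_gt_zero_pi) auto
  have Re_g: "Re (g z) \<ge> k * norm z powr (3 / 2)" if "z \<in> S" for z
  proof -
    let ?p = "c * z + 1"
    have p0: "?p \<noteq> 0" using pos[OF that] by (metis less_irrefl zero_complex.sel(1))
    have "\<bar>Im ?p\<bar> \<le> Re ?p" using S(2)[OF that] by auto
    then have "\<bar>Im ?p / Re ?p\<bar> \<le> 1" using pos[OF that] by (simp add: field_simps)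
    moreover have "\<bar>arctan y\<bar> \<le> pi / 4" if "\<bar>y\<bar> \<le> 1" for y :: real
      using arctan_monotone'[of y 1] arctan_monotone'[of "- 1" y] that
      by (auto simp: arctan_one arctan_minus abs_le_iff)
    moreover have "Im (Ln ?p) = arctan (Im ?p / Re ?p)"
      using arg_conv_arctan[OF pos[OF that]] p0 by (simp add: Arg_def)
    ultimately have "\<bar>Im (Ln ?p)\<bar> \<le> pi / 4" by (simp only:)
    then have cos: "cos (3 / 2 * Im (Ln ?p)) \<ge> k"
      unfolding k_def by (subst cos_abs_real[symmetric], intro cos_monotone_0_pi_le) auto
    have "norm z \<le> norm ?p"
    proof -
      have "(norm (c * z))\<^sup>2 \<le> (norm ?p)\<^sup>2"
        unfolding cmod_power2 using S(2)[OF that] by (simp add: power2_eq_square algebra_simps)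
      then show ?thesis using c by (simp add: norm_mult power2_le_iff_abs_le)
    qed
    then have "k * norm z powr (3 / 2) \<le> k * norm ?p powr (3 / 2)"
      using k by (intro mult_left_mono powr_mono2) auto
    also have "\<dots> \<le> norm ?p powr (3 / 2) * cos (3 / 2 * Im (Ln ?p))"
      by (subst mult.commute[of k]) (intro mult_left_mono cos powr_ge_zero)
    also have "\<dots> = Re (g z)"
      using p0 by (simp add: g_def powr_def Re_exp)
    finally show ?thesis .
  qed
  have g_cont: "continuous_on S g" unfolding g_def
    by (intro continuous_intros) (use nonpos pos in force)+
  have g_hol: "g holomorphic_on interior S" unfolding g_def
    by (intro holomorphic_intros) (use nonpos interior_subset in blast)
  show ?thesis
  proof (rule Phragmen_Lindelof_multiplier[OF S(1) f frontier, where q = "\<lambda>e z. exp (- of_real e * g z)"])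
    show "norm (exp (- of_real e * g z)) \<le> 1" if "e > 0" "z \<in> S" for e z
      using Re_g[OF that(2)] k that(1) by (simp add: order_trans[rotated])
    show "((\<lambda>e. exp (- of_real e * g z)) \<longlongrightarrow> 1) (at_right 0)" for z
    proof -
      have "((\<lambda>e. exp (- of_real e * g z)) \<longlongrightarrow> exp (- of_real 0 * g z)) (at_right 0)"
        by (intro tendsto_intros)
      then show ?thesis by simp
    qed
    show "\<exists>R0. \<forall>z\<in>S. norm z \<ge> R0 \<longrightarrow> norm (f z * exp (- of_real e * g z)) \<le> M" if e: "e > 0" for e
    proof -
      have "((\<lambda>r. B * exp (K * r - e * k * r powr (3 / 2))) \<longlongrightarrow> 0) at_top"
        using e k by real_asymp
      then have "eventually (\<lambda>r. B * exp (K * r - e * k * r powr (3 / 2)) < M) at_top"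
        using M by (rule order_tendstoD)
      then obtain R0 where R0: "\<And>r. r \<ge> R0 \<Longrightarrow> B * exp (K * r - e * k * r powr (3 / 2)) < M"
        by (auto simp: eventually_at_top_linorder)
      have "norm (f z * exp (- of_real e * g z)) \<le> M" if "z \<in> S" "norm z \<ge> R0" for z
      proof -
        have B: "B \<ge> 0" using growth[OF that(1)] norm_ge_zero[of "f z"]
          by (smt (verit) exp_gt_zero mult_neg_pos)
        have "norm (f z * exp (- of_real e * g z)) = norm (f z) * exp (- e * Re (g z))"
          by (simp add: norm_mult)
        also have "\<dots> \<le> (B * exp (K * norm z)) * exp (- (e * k * norm z powr (3 / 2)))"
          using e Re_g[OF that(1)] B by (intro mult_mono growth that(1)) auto
        also have "\<dots> \<le> M" using R0[OF that(2)] by (simp add: exp_diff exp_minus field_simps)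
        finally show ?thesis .
      qed
      then show ?thesis by blast
    qed
  qed (use z in \<open>auto intro!: continuous_intros holomorphic_intros g_cont g_hol\<close>)
qed

lemma interior_halfspace_Re_ge: "interior {z. Re z \<ge> b} = {z. Re z > b}"
  using interior_halfspace_ge[of "1 :: complex" b] by (simp add: inner_complex_def)

text \<open>Improves a crude bound \<open>B\<close> to the bound \<open>M\<close> valid on the
  imaginary axis. As f is already bounded, the weak damping 1 / (1 + e z) suffices.\<close>

lemma Phragmen_Lindelof_right_half_plane_bounded:
  fixes f :: "complex \<Rightarrow> complex"
  assumes f: "continuous_on {z. Re z \<ge> 0} f" "f holomorphic_on {z. Re z > 0}"
    and imag: "\<And>z. Re z = 0 \<Longrightarrow> norm (f z) \<le> M"
    and bound: "\<And>z. Re z \<ge> 0 \<Longrightarrow> norm (f z) \<le> B"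
    and M: "M > 0" and z: "Re z \<ge> 0"
  shows "norm (f z) \<le> M"
proof -
  have int: "interior {z. Re z \<ge> 0} = {z. Re z > 0}" by (rule interior_halfspace_Re_ge)
  have pos: "Re (1 + of_real e * z) \<ge> 1" if "e > 0" "Re z \<ge> 0" for e z using that by simp
  have ne: "1 + of_real e * z \<noteq> 0" if "e > 0" "Re z \<ge> 0" for e z
    using pos[OF that] by (metis not_one_le_zero zero_complex.sel(1))
  show ?thesis
  proof (rule Phragmen_Lindelof_multiplier[where f = f and S = "{z. Re z \<ge> 0}" and q = "\<lambda>e z. 1 / (1 + of_real e * z)"])
    show "closed {z. Re z \<ge> 0}" by (rule closed_halfspace_Re_ge)
    show "norm (f z) \<le> M" if "z \<in> frontier {z. Re z \<ge> 0}" for z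
      by (rule imag) (use that in \<open>auto simp: frontier_def int closed_halfspace_Re_ge\<close>)
    show "norm (1 / (1 + of_real e * z)) \<le> 1" if "e > 0" "z \<in> {z. Re z \<ge> 0}" for e z
      using order_trans[OF pos[of e z] complex_Re_le_cmod] that by (simp add: norm_divide divide_le_eq)
    show "((\<lambda>e. 1 / (1 + of_real e * z)) \<longlongrightarrow> 1) (at_right 0)" for z :: complex
    proof -
      have "((\<lambda>e. 1 / (1 + of_real e * z)) \<longlongrightarrow> 1 / (1 + of_real 0 * z)) (at_right 0)"
        by (intro tendsto_intros) auto
      then show ?thesis by simp
    qed
    show "\<exists>R0. \<forall>z\<in>{z. Re z \<ge> 0}. norm z \<ge> R0 \<longrightarrow> norm (f z * (1 / (1 + of_real e * z))) \<le> M" if e: "e > 0" for e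
    proof (intro exI ballI impI)
      fix z assume z: "z \<in> {z. Re z \<ge> 0}" "norm z \<ge> B / (M * e)"
      have "e * norm z \<le> norm (1 + of_real e * z)"
      proof -
        have "(norm (of_real e * z))\<^sup>2 \<le> (norm (1 + of_real e * z))\<^sup>2"
          unfolding cmod_power2 using z e by (simp add: power2_eq_square algebra_simps)
        then show ?thesis using e by (simp add: norm_mult power2_le_iff_abs_le)
      qed
      moreover have "B \<le> M * (e * norm z)" using z M e by (simp add: field_simps)
      ultimately have "norm (f z) \<le> M * norm (1 + of_real e * z)"
        using bound[of z] z M by (smt (verit) mem_Collect_eq mult_left_mono)
      then show "norm (f z * (1 / (1 + of_real e * z))) \<le> M"
        using ne[of e z] z e by (simp add: norm_mult norm_divide divide_le_eq)
    qed
  qed (use z ne in \<open>auto simp: int intro!: continuous_intros holomorphic_intros f\<close>)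
qed


text \<open>Multiply f by exp(K z). The product keeps its bound on the imaginary axis, is bounded by
  some \<open>C\<close> depending on K on the positive axis, and has order 1, so it is bounded in
  each quadrant. The half-plane principle then replaces this bound by one independent of K, and K
  can tend to infinity.\<close>

lemma superexponential_decay_imp_zero:
  fixes f :: "complex \<Rightarrow> complex"
  assumes f: "continuous_on {z. Re z \<ge> 0} f" "f holomorphic_on {z. Re z > 0}"
    and bound: "\<And>z. Re z \<ge> 0 \<Longrightarrow> norm (f z) \<le> B"
    and decay: "\<And>K. \<exists>C. \<forall>x\<ge>0. norm (f (of_real x)) \<le> C * exp (- K * x)"
    and z: "Re z > 0"
  shows "f z = 0"
proof -
  define M where "M = B + 1"
  have "B \<ge> 0" using order_trans[OF norm_ge_zero bound[of 0]] by simp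
  then have M: "M > 0" "\<And>z. Re z \<ge> 0 \<Longrightarrow> norm (f z) \<le> M"
    using bound by (auto simp: M_def add_increasing2)
  have *: "norm (f z) \<le> M * exp (- K * Re z)" if K: "K > 0" for K
  proof -
    obtain C where C: "\<And>x. x \<ge> 0 \<Longrightarrow> norm (f (of_real x)) \<le> C * exp (- K * x)"
      using decay by blast
    define g where "g z = exp (of_real K * z) * f z" for z
    have norm_g: "norm (g z) = exp (K * Re z) * norm (f z)" for z by (simp add: g_def norm_mult)
    have g: "continuous_on {z. Re z \<ge> 0} g" "g holomorphic_on {z. Re z > 0}"
      unfolding g_def by (intro continuous_intros holomorphic_intros f)+
    have imag: "norm (g z) \<le> M" if "Re z = 0" for z
      using M(2)[of z] that by (simp add: norm_g)
    have real: "norm (g z) \<le> C" if "Re z \<ge> 0" "Im z = 0" for z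
    proof -
      from that have "z = of_real (Re z)" by (simp add: complex_eq_iff)
      with C[OF that(1)] have "norm (f z) \<le> C * exp (- K * Re z)" by simp
      then have "exp (K * Re z) * norm (f z) \<le> exp (K * Re z) * (C * exp (- K * Re z))"
        by (intro mult_left_mono) auto
      then show ?thesis by (simp add: norm_g exp_minus field_simps)
    qed
    have growth: "norm (g z) \<le> M * exp (K * norm z)" if "Re z \<ge> 0" for z
      unfolding norm_g mult.commute[of "exp _"]
      using M K that complex_Re_le_cmod[of z] by (intro mult_mono) auto
    \<comment> \<open>The sign \<sigma> selects the upper or the lower quadrant; the rotation is
      multiplication by exp(-\<sigma> i pi/4).\<close>
    have quadrant: "norm (g z) \<le> max M C" if S: "S = {z. Re z \<ge> 0 \<and> \<sigma> * Im z \<ge> 0}" "z \<in> S" and \<sigma>: "\<bar>\<sigma>\<bar> = 1" for \<sigma> S z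
    proof (rule Phragmen_Lindelof_quarter_plane[where f = g and S = S and c = "Complex (1 / sqrt 2) (- \<sigma> / sqrt 2)" and K = K and B = M])
      have *: "S = {z. Re z \<ge> 0} \<inter> {z. \<sigma> * Im z \<ge> 0}" using S by auto
      show "closed S" unfolding *
        by (intro closed_Int closed_halfspace_Re_ge closed_Collect_le continuous_intros)
      have sub: "S \<subseteq> {z. Re z \<ge> 0}" using S by auto
      show "continuous_on S g" by (rule continuous_on_subset[OF g(1) sub])
      have int: "interior S \<subseteq> {z. Re z > 0}"
        using interior_mono[OF sub] by (simp add: interior_halfspace_Re_ge)
      show "g holomorphic_on interior S" by (rule holomorphic_on_subset[OF g(2) int])
      show "norm (Complex (1 / sqrt 2) (- \<sigma> / sqrt 2)) = 1"
        using \<sigma> by (auto simp: cmod_def power_divide abs_if split: if_splits)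
      show "\<bar>Im (Complex (1 / sqrt 2) (- \<sigma> / sqrt 2) * z)\<bar> \<le> Re (Complex (1 / sqrt 2) (- \<sigma> / sqrt 2) * z)" if "z \<in> S" for z
      proof -
        from that S(1) have "Re z \<ge> 0" "\<sigma> * Im z \<ge> 0" by auto
        moreover have "\<bar>Im z - \<sigma> * Re z\<bar> = \<bar>\<sigma> * (Im z - \<sigma> * Re z)\<bar>"
          using \<sigma> by (simp add: abs_mult)
        moreover have "\<sigma> * (Im z - \<sigma> * Re z) = \<sigma> * Im z - Re z"
          using \<sigma> by (auto simp: abs_if split: if_splits)
        ultimately have "\<bar>Im z - \<sigma> * Re z\<bar> / sqrt 2 \<le> (Re z + \<sigma> * Im z) / sqrt 2"
          by (intro divide_right_mono) auto
        moreover have "\<bar>Im z - \<sigma> * Re z\<bar> / sqrt 2 = \<bar>(Im z - \<sigma> * Re z) / sqrt 2\<bar>" by simp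
        ultimately show ?thesis by (simp add: diff_divide_distrib add_divide_distrib)
      qed
      show "norm (g z) \<le> max M C" if "z \<in> frontier S" for z
      proof -
        have "frontier S \<subseteq> S" using \<open>closed S\<close> by (rule frontier_subset_closed)
        moreover have "open {z. Re z > 0 \<and> \<sigma> * Im z > 0}"
          by (intro open_Collect_conj open_Collect_less continuous_intros)
        then have "{z. Re z > 0 \<and> \<sigma> * Im z > 0} \<subseteq> interior S"
          by (intro interior_maximal) (auto simp: S)
        ultimately have "z \<in> S" "\<not> (Re z > 0 \<and> \<sigma> * Im z > 0)"
          using that by (auto simp: frontier_def)
        then have "Re z \<ge> 0" "Re z = 0 \<or> \<sigma> * Im z = 0"
          using S by auto
        with real imag \<sigma> show ?thesis by (force simp: le_max_iff_disj)
      qed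
      show "norm (g z) \<le> M * exp (K * norm z)" if "z \<in> S" for z using growth that sub by auto
      show "0 < max M C" using M by simp
    qed (rule S)
    have "norm (g z) \<le> M"
    proof (rule Phragmen_Lindelof_right_half_plane_bounded[OF g imag _ M(1)])
      show "norm (g z) \<le> max M C" if "Re z \<ge> 0" for z
      proof (cases "Im z \<ge> 0")
        case True
        then show ?thesis using quadrant[OF refl, of z 1] that by simp
      next
        case False
        then show ?thesis using quadrant[OF refl, of z "-1"] that by simp
      qed
    qed (use z in auto)
    then show ?thesis by (simp add: norm_g exp_minus field_simps)
  qed
  have "((\<lambda>K. M * exp (- K * Re z)) \<longlongrightarrow> 0) at_top"
    using z by real_asymp
  moreover have "eventually (\<lambda>K. norm (f z) \<le> M * exp (- K * Re z)) at_top"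
    using eventually_gt_at_top[of 0] by eventually_elim (rule *)
  ultimately have "norm (f z) \<le> 0"
    by (rule tendsto_lowerbound) simp
  then show ?thesis by simp
qed

section \<open>The critical region\<close>

text \<open>This is sin a * cos a \<le> a at a = arctan y.\<close>

lemma arctan_ge: "y / (1 + y\<^sup>2) \<le> arctan y" if "y \<ge> 0" for y :: real
proof -
  have "sin (arctan y) * cos (arctan y) \<le> arctan y * 1"
    using that by (intro mult_mono sin_x_le_x cos_le_one) (auto simp: sin_arctan cos_arctan)
  moreover have "sqrt (1 + y\<^sup>2) * sqrt (1 + y\<^sup>2) = 1 + y\<^sup>2"
    by (rule real_sqrt_mult_self[THEN trans]) (simp add: add_nonneg_nonneg)
  ultimately show ?thesis by (simp add: sin_arctan cos_arctan)
qed

(* The lower bound that cos_sub_arctan_ge gives for cos (Arg w), where w = log_map beta z and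
   L = ln |z|; it behaves like pi * beta / (2 * L). *)
definition log_slope :: "real \<Rightarrow> real \<Rightarrow> real" where
  "log_slope \<beta> L = sin (pi / 2 * (\<beta> / (1 + (pi / (2 * L))\<^sup>2) / L))"

text \<open>If \<phi> is the argument of z and L = ln|z|, the angle on the right is the argument of
  \<open>log_map \<beta> z\<close>. The arctangent term keeps it away from the right angle even when
  |\<phi>| = pi/2. After a linear lower bound for the arctangent, the worst case is |\<phi>| = pi/2,
  because \<beta> \<le> L makes the resulting upper bound for the angle nondecreasing in
  |\<phi>|.\<close>

lemma cos_sub_arctan_ge:
  assumes "\<bar>\<phi>\<bar> \<le> pi / 2" "0 < \<beta>" "\<beta> \<le> L"
  shows "log_slope \<beta> L \<le> cos (\<phi> - \<beta> * arctan (\<phi> / L))"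
proof -
  define y where "y = \<bar>\<phi>\<bar> / L"
  \<comment> \<open>The factor 1 / (1 + y^2) of \<open>arctan_ge\<close> at the largest possible y,
    so that one slope serves all \<phi>.\<close>
  define q where "q = 1 / (1 + (pi / (2 * L))\<^sup>2)"
  have L: "L > 0" using assms by simp
  have y: "y \<ge> 0" "y \<le> pi / (2 * L)" using assms L by (auto simp: y_def field_simps)
  have q: "0 < q" "q \<le> 1"
  proof -
    have "0 < 1 / (1 + r) \<and> 1 / (1 + r) \<le> 1" if "r \<ge> 0" for r :: real
      using that by (simp add: divide_simps)
    from this[OF zero_le_power2] show "0 < q" "q \<le> 1" by (simp_all only: q_def)
  qed
  have "\<beta> * arctan y \<le> \<beta> * y" using assms y by (intro mult_left_mono arctan_le_self) auto
  also have "\<dots> \<le> \<bar>\<phi>\<bar>"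
    using assms L mult_right_mono[of \<beta> L "\<bar>\<phi>\<bar>"] by (simp add: y_def field_simps)
  finally have le: "\<beta> * arctan y \<le> \<bar>\<phi>\<bar>" .
  have "y * q \<le> y / (1 + y\<^sup>2)"
    unfolding q_def using y by (auto intro!: divide_left_mono power_mono mult_pos_pos simp: add_pos_nonneg)
  also have "\<dots> \<le> arctan y" by (rule arctan_ge) (rule y)
  finally have ge: "\<beta> * (y * q) \<le> \<beta> * arctan y" using assms by simp
  \<comment> \<open>The gap between the angle and pi/2; its sine is the cosine sought.\<close>
  define \<tau> where "\<tau> = pi / 2 - (\<bar>\<phi>\<bar> - \<beta> * arctan y)"
  have "\<beta> * q / L \<le> 1"
    using assms L q mult_mono[of \<beta> L q 1] by (simp add: divide_le_eq)
  then have "\<bar>\<phi>\<bar> * (1 - \<beta> * q / L) \<le> pi / 2 * (1 - \<beta> * q / L)"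
    using assms by (intro mult_right_mono) auto
  then have "\<bar>\<phi>\<bar> - \<bar>\<phi>\<bar> * (\<beta> * q / L) \<le> pi / 2 - pi / 2 * (\<beta> * q / L)"
    by (simp only: right_diff_distrib mult_1_right)
  moreover have "\<beta> * (y * q) = \<bar>\<phi>\<bar> * (\<beta> * q / L)" by (simp add: y_def)
  ultimately have \<tau>: "pi / 2 * (\<beta> * q / L) \<le> \<tau>" "\<tau> \<le> pi / 2"
    using le ge unfolding \<tau>_def by linarith+
  have "0 \<le> pi / 2 * (\<beta> * q / L)" using assms q L by simp
  then have "- (pi / 2) \<le> pi / 2 * (\<beta> * q / L)" using pi_gt_zero by linarith
  then have "sin (pi / 2 * (\<beta> * q / L)) \<le> sin \<tau>"
    using \<tau> by (intro sin_monotone_2pi_le)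
  also have "\<dots> = cos \<bar>\<phi> - \<beta> * arctan (\<phi> / L)\<bar>"
  proof -
    have "\<bar>\<phi> - \<beta> * arctan (\<phi> / L)\<bar> = \<bar>\<phi>\<bar> - \<beta> * arctan y"
    proof (cases "\<phi> \<ge> 0")
      case True
      then show ?thesis using le by (simp add: y_def)
    next
      case False
      then have "arctan y = - arctan (\<phi> / L)" by (simp add: y_def arctan_minus[symmetric])
      with False le show ?thesis by simp
    qed
    then show ?thesis by (simp add: \<tau>_def sin_diff cos_diff)
  qed
  finally show ?thesis by (simp add: log_slope_def q_def)
qed

text \<open>Written as an exponential so that ln of the modulus and the argument are the real and
  imaginary parts of the exponent.\<close>

definition log_map :: "real \<Rightarrow> complex \<Rightarrow> complex" where
  "log_map \<beta> z = exp (Ln z - of_real \<beta> * Ln (Ln z))"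

lemma log_map_of_real:
  "x > 1 \<Longrightarrow> log_map \<beta> (of_real x) = of_real (exp (ln x - \<beta> * ln (ln x)))"
  by (simp add: log_map_def Ln_of_real exp_of_real flip: of_real_mult of_real_diff)

lemma log_map_holomorphic: "log_map \<beta> holomorphic_on {z. Re z > 1}"
proof -
  have "z \<notin> \<real>\<^sub>\<le>\<^sub>0 \<and> Ln z \<notin> \<real>\<^sub>\<le>\<^sub>0" if "Re z > 1" for z
  proof -
    have "norm z > 1" using that complex_Re_le_cmod[of z] by linarith
    then have "Re (Ln z) > 0" using Re_Ln[of z] ln_gt_zero[of "norm z"] by fastforce
    with that show ?thesis by (auto simp: complex_nonpos_Reals_iff)
  qed
  then show ?thesis
    unfolding log_map_def by (intro holomorphic_intros) auto
qed

text \<open>Since |arg z| \<le> pi/2, the modulus of \<open>Ln z\<close> is at most sqrt(L^2 +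
  (pi/2)^2). Both estimates depend on |z| alone, hence are uniform over half-circles; together they
  bound Re w from below and |w| / Re w from above for w = \<open>log_map \<beta> z\<close>.\<close>

lemma log_map_bounds:
  assumes "Re z > 0" "0 < \<beta>" "\<beta> \<le> L" and L: "L = ln (norm z)"
  shows "norm (log_map \<beta> z) * log_slope \<beta> L \<le> Re (log_map \<beta> z)"
    and "ln (norm (log_map \<beta> z)) \<ge> L - \<beta> / 2 * ln (L\<^sup>2 + (pi / 2)\<^sup>2)"
proof -
  have z0: "z \<noteq> 0" using assms(1) by auto
  define \<phi> where "\<phi> = Im (Ln z)"
  have \<phi>: "\<bar>\<phi>\<bar> \<le> pi / 2" using Re_Ln_pos_lt_imp[OF assms(1)] by (simp add: \<phi>_def)
  have Re: "Re (Ln z) = L" using z0 by (simp add: L)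
  have Lpos: "L > 0" using assms by simp
  have ne: "Ln z \<noteq> 0" using Re Lpos by auto
  have Im: "Im (Ln (Ln z)) = arctan (\<phi> / L)"
    using arg_conv_arctan[of "Ln z"] Re Lpos ne by (simp add: Arg_def \<phi>_def)
  have norm: "norm (log_map \<beta> z) = exp (L - \<beta> * ln (norm (Ln z)))"
    using Re ne by (simp add: log_map_def)
  have "Re (log_map \<beta> z) = norm (log_map \<beta> z) * cos (\<phi> - \<beta> * arctan (\<phi> / L))"
    unfolding norm using Re ne Im by (simp add: log_map_def Re_exp \<phi>_def)
  with cos_sub_arctan_ge[OF \<phi> assms(2,3)]
  show "norm (log_map \<beta> z) * log_slope \<beta> L \<le> Re (log_map \<beta> z)"
    by (simp add: mult_left_mono)
  have sum_pos: "L\<^sup>2 + (pi / 2)\<^sup>2 > 0" using Lpos by (simp add: add_pos_nonneg)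
  have "norm (Ln z) \<le> sqrt (L\<^sup>2 + (pi / 2)\<^sup>2)"
    unfolding cmod_def Re \<phi>_def[symmetric] using abs_le_square_iff[of \<phi> "pi / 2"] \<phi> by simp
  then have "ln (norm (Ln z)) \<le> ln (sqrt (L\<^sup>2 + (pi / 2)\<^sup>2))"
    using ne sum_pos by (subst ln_le_cancel_iff) auto
  also have "\<dots> = ln (L\<^sup>2 + (pi / 2)\<^sup>2) / 2"
    by (rule ln_sqrt[OF less_imp_le[OF sum_pos]])
  finally have "\<beta> * ln (norm (Ln z)) \<le> \<beta> * (ln (L\<^sup>2 + (pi / 2)\<^sup>2) / 2)"
    using assms by simp
  then show "ln (norm (log_map \<beta> z)) \<ge> L - \<beta> / 2 * ln (L\<^sup>2 + (pi / 2)\<^sup>2)"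
    by (simp add: norm)
qed

text \<open>As \<open>log_slope \<beta> L\<close> is about pi \<beta> / (2 L), dividing the last
  inequality by L^2 leaves 4 \<kappa> \<theta>^2 / (pi \<beta>)^2 < 1 in the limit, which is the
  hypothesis. The inequality says that the image of \<open>log_map\<close> lies in the critical
  region.\<close>

lemma log_slope_asymp:
  fixes \<kappa> \<theta> \<beta> :: real
  assumes "\<kappa> > 0" "\<theta> > 0" "\<beta> > 0" "4 * \<kappa> * \<theta>\<^sup>2 < (pi * \<beta>)\<^sup>2"
  shows "eventually (\<lambda>L. log_slope \<beta> L > 0 \<and>
      L - \<beta> / 2 * ln (L\<^sup>2 + (pi / 2)\<^sup>2) + ln (log_slope \<beta> L) > 0 \<and>
      \<theta>\<^sup>2 + \<kappa> * \<theta>\<^sup>2 / (log_slope \<beta> L)\<^sup>2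
        \<le> (L - \<beta> / 2 * ln (L\<^sup>2 + (pi / 2)\<^sup>2) + ln (log_slope \<beta> L))\<^sup>2) at_top"
proof -
  have 1: "((\<lambda>L. log_slope \<beta> L * L) \<longlongrightarrow> pi / 2 * \<beta>) at_top"
    unfolding log_slope_def using assms by real_asymp
  have 2: "((\<lambda>L. (L - \<beta> / 2 * ln (L\<^sup>2 + (pi / 2)\<^sup>2) + ln (log_slope \<beta> L)) / L) \<longlongrightarrow> 1) at_top"
    unfolding log_slope_def using assms by real_asymp
  define c where "c = pi / 2 * \<beta>"
  have c: "c > 0" "\<kappa> * \<theta>\<^sup>2 / c\<^sup>2 < 1" using assms by (auto simp: c_def field_simps power2_eq_square)
  have "((\<lambda>L. \<theta>\<^sup>2 / L\<^sup>2 + \<kappa> * \<theta>\<^sup>2 / (log_slope \<beta> L * L)\<^sup>2 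
     - ((L - \<beta> / 2 * ln (L\<^sup>2 + (pi / 2)\<^sup>2) + ln (log_slope \<beta> L)) / L)\<^sup>2) \<longlongrightarrow>
      0 + \<kappa> * \<theta>\<^sup>2 / c\<^sup>2 - 1\<^sup>2) at_top"
    using c by (intro tendsto_intros 1[folded c_def] 2) (real_asymp | simp)+
  then have 3: "eventually (\<lambda>L. \<theta>\<^sup>2 / L\<^sup>2 + \<kappa> * \<theta>\<^sup>2 / (log_slope \<beta> L * L)\<^sup>2 
     - ((L - \<beta> / 2 * ln (L\<^sup>2 + (pi / 2)\<^sup>2) + ln (log_slope \<beta> L)) / L)\<^sup>2 < 0) at_top"
    by (rule order_tendstoD) (use c in simp)
  have 4: "eventually (\<lambda>L. log_slope \<beta> L * L > 0) at_top"
    by (rule order_tendstoD[OF 1]) (use assms in simp)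
  have 5: "eventually (\<lambda>L. (L - \<beta> / 2 * ln (L\<^sup>2 + (pi / 2)\<^sup>2) + ln (log_slope \<beta> L)) / L > 0) at_top"
    by (rule order_tendstoD[OF 2]) simp
  from 3 4 5 eventually_gt_at_top[of 0] show ?thesis
  proof eventually_elim
    case (elim L)
    define m where "m = log_slope \<beta> L"
    define l where "l = L - \<beta> / 2 * ln (L\<^sup>2 + (pi / 2)\<^sup>2) + ln (log_slope \<beta> L)"
    have m: "m > 0" and l: "l > 0" using elim by (auto simp: m_def l_def zero_less_mult_iff zero_less_divide_iff)
    have "\<theta>\<^sup>2 / L\<^sup>2 + \<kappa> * \<theta>\<^sup>2 / (m * L)\<^sup>2 < (l / L)\<^sup>2" using elim by (simp add: m_def l_def)
    then have "(\<theta>\<^sup>2 + \<kappa> * \<theta>\<^sup>2 / m\<^sup>2) / L\<^sup>2 < l\<^sup>2 / L\<^sup>2"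
      by (simp add: add_divide_distrib power_mult_distrib power_divide)
    then have "\<theta>\<^sup>2 + \<kappa> * \<theta>\<^sup>2 / m\<^sup>2 < l\<^sup>2"
      using elim by (simp add: divide_less_cancel)
    with m l show ?case unfolding m_def l_def by simp
  qed
qed

section \<open>Vanishing of a function small on the critical region\<close>

lemma holomorphic_right_half_plane_zero:
  fixes G :: "complex \<Rightarrow> complex"
  assumes G: "G holomorphic_on {w. Re w > 0}"
    and pos: "\<kappa> > 0" "\<theta> > 0" "\<kappa> * \<theta>\<^sup>2 < pi\<^sup>2"
    and bound: "\<And>w T. Re w > 0 \<Longrightarrow> T \<ge> 0 \<Longrightarrow>
      norm (G w) \<le> B * exp (- T * Re w + exp (\<theta> * sqrt T) + \<kappa> * (norm w)\<^sup>2 / Re w)"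
    and w: "Re w > 0"
  shows "G w = 0"
proof -
  \<comment> \<open>The midpoint of the admissible interval from 2 sqrt \<kappa> \<theta> / pi to
    2.\<close>
  define \<beta> where "\<beta> = 1 + sqrt \<kappa> * \<theta> / pi"
  have "(sqrt \<kappa> * \<theta>)\<^sup>2 < pi\<^sup>2" using pos by (simp add: power_mult_distrib)
  then have less_pi: "sqrt \<kappa> * \<theta> < pi" by (rule power2_less_imp_less) simp
  then have \<beta>: "\<beta> > 0" "\<beta> < 2" using pos by (auto simp: \<beta>_def add_pos_nonneg)
  have "pi * \<beta> = pi + sqrt \<kappa> * \<theta>" by (simp add: \<beta>_def field_simps)
  with less_pi have "2 * (sqrt \<kappa> * \<theta>) < pi * \<beta>" by linarith
  then have "(2 * (sqrt \<kappa> * \<theta>))\<^sup>2 < (pi * \<beta>)\<^sup>2"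
    using pos by (intro power_strict_mono) auto
  then have "4 * \<kappa> * \<theta>\<^sup>2 < (pi * \<beta>)\<^sup>2" using pos by (simp add: power_mult_distrib)
  from log_slope_asymp[OF pos(1,2) \<beta>(1) this]
  obtain L0 where L0: "\<And>L. L \<ge> L0 \<Longrightarrow> log_slope \<beta> L > 0 \<and>
      L - \<beta> / 2 * ln (L\<^sup>2 + (pi / 2)\<^sup>2) + ln (log_slope \<beta> L) > 0 \<and>
      \<theta>\<^sup>2 + \<kappa> * \<theta>\<^sup>2 / (log_slope \<beta> L)\<^sup>2
        \<le> (L - \<beta> / 2 * ln (L\<^sup>2 + (pi / 2)\<^sup>2) + ln (log_slope \<beta> L))\<^sup>2"
    unfolding eventually_at_top_linorder by blast

  have bound': "norm (G w) \<le> B * exp (Re w / \<theta>\<^sup>2 * (\<theta>\<^sup>2 + \<kappa> * \<theta>\<^sup>2 * (norm w / Re w)\<^sup>2 - (ln (Re w))\<^sup>2))"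
    if "Re w \<ge> 1" for w
  proof -
    \<comment> \<open>Re w \<ge> 1 makes ln (Re w) nonnegative, so that it really equals \<theta> *
      sqrt T.\<close>
    define T where "T = (ln (Re w) / \<theta>)\<^sup>2"
    have "sqrt T = ln (Re w) / \<theta>" unfolding T_def using that pos by (intro real_sqrt_unique) auto
    then have "exp (\<theta> * sqrt T) = Re w" using pos that by simp
    then have "- T * Re w + exp (\<theta> * sqrt T) + \<kappa> * (norm w)\<^sup>2 / Re w
        = Re w / \<theta>\<^sup>2 * (\<theta>\<^sup>2 + \<kappa> * \<theta>\<^sup>2 * (norm w / Re w)\<^sup>2 - (ln (Re w))\<^sup>2)"
      using that pos by (simp add: T_def field_simps power2_eq_square)
    with bound[of w T] that show ?thesis by (simp add: T_def)
  qed
  have B: "B \<ge> 0"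
  proof (rule ccontr)
    assume "\<not> B \<ge> 0"
    then have "B * exp y < 0" for y by (simp add: mult_neg_pos)
    with order_trans[OF norm_ge_zero bound[of 1 0]] show False by (simp add: not_le[symmetric])
  qed

  \<comment> \<open>\<open>L0\<close> is where the asymptotic inequalities begin, \<beta> is the
    threshold in \<open>log_map_bounds\<close>, and 1 ensures R > 1, where \<open>log_map\<close> is
    holomorphic.\<close>
  define L1 where "L1 = max L0 (max \<beta> 1)"
  define R where "R = exp L1"
  have R: "R > 1" by (simp add: R_def L1_def)
  have map: "Re (log_map \<beta> z) > 0" "norm (G (log_map \<beta> z)) \<le> B" if "Re z \<ge> R" for z
  proof -
    define L where "L = ln (norm z)"
    have z: "Re z > 0" "norm z \<ge> R" using that R complex_Re_le_cmod[of z] by linarith+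
    then have "L \<ge> ln R" using R unfolding L_def by (intro ln_mono) linarith+
    then have L: "L \<ge> L0" "L \<ge> \<beta>" by (simp_all add: R_def L1_def)
    define m where "m = log_slope \<beta> L"
    define l where "l = L - \<beta> / 2 * ln (L\<^sup>2 + (pi / 2)\<^sup>2) + ln m"
    have ml: "m > 0" "l > 0" "\<theta>\<^sup>2 + \<kappa> * \<theta>\<^sup>2 / m\<^sup>2 \<le> l\<^sup>2"
      using L0[OF L(1)] by (auto simp: m_def l_def)
    define w where "w = log_map \<beta> z"
    have w0: "norm w > 0" by (simp add: w_def log_map_def)
    have le: "norm w * m \<le> Re w" "ln (norm w) + ln m \<ge> l"
      using log_map_bounds[OF z(1) \<beta>(1) L(2) L_def] by (auto simp: w_def m_def l_def)
    have "norm w * m > 0" using w0 ml by simp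
    then have Re_pos: "Re w > 0" using le by linarith
    have "l \<le> ln (norm w * m)" using le w0 ml by (simp add: ln_mult_pos)
    also have "\<dots> \<le> ln (Re w)" using le \<open>norm w * m > 0\<close> by (intro ln_mono)
    finally have ln_ge: "l \<le> ln (Re w)" .
    then have "Re w \<ge> 1" using ml Re_pos by (metis less_imp_le ln_ge_zero_iff order_trans)
    have "norm w / Re w \<le> 1 / m" using le Re_pos ml by (simp add: field_simps)
    then have "(norm w / Re w)\<^sup>2 \<le> (1 / m)\<^sup>2" using Re_pos by (intro power_mono) auto
    then have "\<kappa> * \<theta>\<^sup>2 * (norm w / Re w)\<^sup>2 \<le> \<kappa> * \<theta>\<^sup>2 * (1 / m)\<^sup>2"
      using pos by (intro mult_left_mono) auto
    also have "\<dots> = \<kappa> * \<theta>\<^sup>2 / m\<^sup>2" by (simp add: power_divide)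
    finally have "\<theta>\<^sup>2 + \<kappa> * \<theta>\<^sup>2 * (norm w / Re w)\<^sup>2 \<le> l\<^sup>2" using ml by simp
    also have "\<dots> \<le> (ln (Re w))\<^sup>2" using ln_ge ml by (intro power_mono) auto
    finally have "Re w / \<theta>\<^sup>2 * (\<theta>\<^sup>2 + \<kappa> * \<theta>\<^sup>2 * (norm w / Re w)\<^sup>2 - (ln (Re w))\<^sup>2) \<le> 0"
      using Re_pos pos by (intro mult_nonneg_nonpos) auto
    then have "B * exp (Re w / \<theta>\<^sup>2 * (\<theta>\<^sup>2 + \<kappa> * \<theta>\<^sup>2 * (norm w / Re w)\<^sup>2 - (ln (Re w))\<^sup>2)) \<le> B * 1"
      using B by (intro mult_left_mono) auto
    with bound'[OF \<open>Re w \<ge> 1\<close>] Re_pos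
    show "Re (log_map \<beta> z) > 0" "norm (G (log_map \<beta> z)) \<le> B" by (auto simp: w_def)
  qed

  define H where "H z = G (log_map \<beta> (z + of_real R))" for z
  have H: "H holomorphic_on {z. Re z \<ge> 0}"
  proof -
    have "(\<lambda>z. log_map \<beta> (z + of_real R)) holomorphic_on {z. Re z \<ge> 0}"
      by (rule holomorphic_on_compose_gen[OF _ log_map_holomorphic, unfolded o_def])
        (use R in \<open>auto intro!: holomorphic_intros\<close>)
    then show ?thesis unfolding H_def
      by (rule holomorphic_on_compose_gen[OF _ G, unfolded o_def]) (use map in auto)
  qed
  have H0: "H z = 0" if "Re z > 0" for z
  proof (rule superexponential_decay_imp_zero[OF _ _ _ _ that])
    show "continuous_on {z. Re z \<ge> 0} H" by (rule holomorphic_on_imp_continuous_on[OF H])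
    show "H holomorphic_on {z. Re z > 0}" by (rule holomorphic_on_subset[OF H]) auto
    show "norm (H z) \<le> B" if "Re z \<ge> 0" for z using map(2)[of "z + of_real R"] that by (simp add: H_def)
    fix K :: real
    define a where "a x = exp (ln (x + R) - \<beta> * ln (ln (x + R)))" for x
    have "eventually (\<lambda>x. a x \<ge> 1) at_top"
      unfolding a_def using \<beta> by real_asymp
    \<comment> \<open>\<open>a x\<close> is about x / (ln x)^\<beta> and the bracket about -(ln
      x)^2; their product beats every linear function because \<beta> < 2.\<close>
    moreover have "eventually (\<lambda>x. a x / \<theta>\<^sup>2 * (\<theta>\<^sup>2 + \<kappa> * \<theta>\<^sup>2 - (ln (x + R) - \<beta> * ln (ln (x + R)))\<^sup>2) \<le> - K * x) at_top"
      unfolding a_def using \<beta> pos by real_asymp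
    ultimately have "eventually (\<lambda>x. norm (H (of_real x)) \<le> B * exp (- K * x)) at_top"
      using eventually_gt_at_top[of 0]
    proof eventually_elim
      case (elim x)
      have "log_map \<beta> (of_real x + of_real R) = of_real (a x)"
        using log_map_of_real[of "x + R" \<beta>] elim R by (simp add: a_def)
      moreover have "norm (G (of_real (a x))) \<le> B * exp (a x / \<theta>\<^sup>2 * (\<theta>\<^sup>2 + \<kappa> * \<theta>\<^sup>2 - (ln (x + R) - \<beta> * ln (ln (x + R)))\<^sup>2))"
        using bound'[of "of_real (a x)"] elim by (simp add: a_def)
      moreover have "\<dots> \<le> B * exp (- K * x)" using B elim by (intro mult_left_mono) auto
      ultimately show ?case by (simp add: H_def)
    qed
    then obtain X where X: "\<And>x. x \<ge> X \<Longrightarrow> norm (H (of_real x)) \<le> B * exp (- K * x)"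
      unfolding eventually_at_top_linorder by blast
    show "\<exists>C. \<forall>x\<ge>0. norm (H (of_real x)) \<le> C * exp (- K * x)"
    \<comment> \<open>The extra constant covers x < X, where only the crude bound \<open>B\<close>
      is available.\<close>
    proof (intro exI[of _ "B * exp (\<bar>K\<bar> * \<bar>X\<bar>)"] allI impI)
      fix x :: real assume x: "x \<ge> 0"
      show "norm (H (of_real x)) \<le> B * exp (\<bar>K\<bar> * \<bar>X\<bar>) * exp (- K * x)"
      proof (cases "x \<ge> X")
        case True
        have "B * exp (- K * x) * 1 \<le> B * exp (- K * x) * exp (\<bar>K\<bar> * \<bar>X\<bar>)"
          using B by (intro mult_left_mono) auto
        with X[OF True] show ?thesis by (simp add: mult_ac)
      next
        case False
        have "K * x \<le> \<bar>K\<bar> * \<bar>X\<bar>" using False x by (intro mult_mono) auto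
        have "norm (H (of_real x)) \<le> B * 1"
          using map(2)[of "of_real x + of_real R"] x by (simp add: H_def)
        also have "\<dots> \<le> B * exp (\<bar>K\<bar> * \<bar>X\<bar> - K * x)"
          using \<open>K * x \<le> \<bar>K\<bar> * \<bar>X\<bar>\<close> B by (intro mult_left_mono) auto
        also have "\<dots> = B * exp (\<bar>K\<bar> * \<bar>X\<bar>) * exp (- K * x)"
          by (simp add: exp_diff exp_minus divide_inverse)
        finally show ?thesis .
      qed
    qed
  qed

  \<comment> \<open>G vanishes on the image of \<open>U\<close>. This image is open by the open
    mapping theorem, \<open>log_map\<close> being unbounded on the positive axis and hence not
    constant, and the identity theorem does the rest.\<close>
  define U where "U = {z. Re z > R}"
  have hol: "log_map \<beta> holomorphic_on U"
    by (rule holomorphic_on_subset[OF log_map_holomorphic]) (use R in \<open>auto simp: U_def\<close>)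
  have U: "open U" "connected U"
    by (auto simp: U_def open_halfspace_Re_gt intro!: convex_connected convex_halfspace_Re_gt)
  have "\<not> log_map \<beta> constant_on U"
  proof
    assume "log_map \<beta> constant_on U"
    then obtain c where c: "\<And>z. z \<in> U \<Longrightarrow> log_map \<beta> z = c" by (auto simp: constant_on_def)
    have "eventually (\<lambda>x. exp (ln x - \<beta> * ln (ln x)) > norm c) at_top"
      using \<beta> by real_asymp
    then have "eventually (\<lambda>x. exp (ln x - \<beta> * ln (ln x)) > norm c \<and> x > R) at_top"
      using eventually_gt_at_top[of R] by (rule eventually_conj)
    then obtain x where x: "exp (ln x - \<beta> * ln (ln x)) > norm c" "x > R"
      using eventually_happens'[OF trivial_limit_at_top_linorder] by blast
    with c[of "of_real x"] log_map_of_real[of x \<beta>] R show False by (auto simp: U_def)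
  qed
  then have "open (log_map \<beta> ` U)" using hol U by (intro open_mapping_thm[of _ U]) auto
  moreover have "G v = 0" if "v \<in> log_map \<beta> ` U" for v
    using that H0[of "z - of_real R" for z] by (force simp: U_def H_def)
  moreover have "of_real (R + 1) \<in> U" by (simp add: U_def)
  then have "log_map \<beta> ` U \<noteq> {}" by blast
  moreover have "log_map \<beta> ` U \<subseteq> {w. Re w > 0}" using map(1) by (auto simp: U_def)
  ultimately show ?thesis
    using analytic_continuation_open[of "log_map \<beta> ` U" "{w. Re w > 0}" G "\<lambda>_. 0" w] G w
      open_halfspace_Re_gt[of 0] convex_connected[OF convex_halfspace_Re_gt[of 0]] by auto
qed

section \<open>Laplace transforms\<close>

text \<open>The rate \<open>c\<close> may be negative; \<open>laplace_unique\<close> applies the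
  estimate with both signs.\<close>

lemma norm_integral_le_exp:
  fixes g :: "real \<Rightarrow> complex"
  assumes "continuous_on {p..q} g" "\<And>x. x \<in> {p..q} \<Longrightarrow> norm (g x) \<le> C * exp (- c * x)" "p \<le> q" "c \<noteq> 0"
  shows "norm (integral {p..q} g) \<le> C * (exp (- c * p) - exp (- c * q)) / c"
proof -
  have I: "((\<lambda>x. C * exp (- c * x)) has_integral (- C * exp (- c * q) / c - (- C * exp (- c * p) / c))) {p..q}"
    using assms(3,4) by (intro fundamental_theorem_of_calculus)
      (auto intro!: derivative_eq_intros simp: has_real_derivative_iff_has_vector_derivative[symmetric])
  have "norm (integral {p..q} g) \<le> integral {p..q} (\<lambda>x. C * exp (- c * x))"
    using assms(1,2) I by (intro integral_norm_bound_integral integrable_continuous_interval has_integral_integrable[OF I])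
  also have "\<dots> = - C * exp (- c * q) / c - (- C * exp (- c * p) / c)" by (rule integral_unique[OF I])
  also have "\<dots> = C * (exp (- c * p) - exp (- c * q)) / c"
    by (simp add: right_diff_distrib diff_divide_distrib)
  finally show ?thesis .
qed

text \<open>Truncation keeps the transform entire and all manipulations of the integral equation on
  compact rectangles; N tends to infinity only afterwards.\<close>

definition laplace_upto :: "real \<Rightarrow> (real \<Rightarrow> complex) \<Rightarrow> complex \<Rightarrow> complex" where
  "laplace_upto N f s = integral {0..N} (\<lambda>x. exp (- s * of_real x) * f x)"

lemma laplace_upto_holomorphic:
  assumes "continuous_on {0..N} f" shows "laplace_upto N f holomorphic_on UNIV"
proof -
  have "(\<lambda>s. integral (cbox 0 N) (\<lambda>x. exp (- s * of_real x) * f x)) holomorphic_on UNIV"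
  proof (rule leibniz_rule_holomorphic)
    show "((\<lambda>s. exp (- s * of_real x) * f x) has_field_derivative - of_real x * exp (- s * of_real x) * f x) (at s within UNIV)" for s x
      by (auto intro!: derivative_eq_intros)
    show "continuous_on (UNIV \<times> cbox 0 N) (\<lambda>(s, x). - of_real x * exp (- s * of_real x) * f x)"
      unfolding split_beta by (intro continuous_intros continuous_on_compose2[OF assms]) auto
    show "(\<lambda>x. exp (- s * of_real x) * f x) integrable_on cbox 0 N" for s
      by (intro integrable_continuous continuous_intros continuous_on_subset[OF assms]) auto
  qed auto
  then show ?thesis by (simp add: laplace_upto_def[abs_def])
qed

text \<open>The tail estimate is uniform in M and on Re s \<ge> b, which gives both the uniform
  Cauchy property and, in the limit M to infinity, a bound for the missing tail.\<close>

lemma laplace_upto_diff: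
  assumes f: "continuous_on {0..} f" and "0 \<le> N" "N \<le> M"
    and bound: "\<And>x. x \<ge> 0 \<Longrightarrow> norm (f x) \<le> C * exp (a * x)" and "a < b" "b \<le> Re s"
  shows "norm (laplace_upto M f s - laplace_upto N f s) \<le> C * exp (- (b - a) * N) / (b - a)"
proof -
  let ?g = "\<lambda>x. exp (- s * of_real x) * f x"
  have C: "C \<ge> 0" using order_trans[OF norm_ge_zero bound[of 0]] by simp
  have c: "continuous_on {p..q} ?g" if "p \<ge> 0" for p q
    by (intro continuous_intros continuous_on_subset[OF f]) (use that in auto)
  have "laplace_upto M f s = laplace_upto N f s + integral {N..M} ?g"
    unfolding laplace_upto_def
    using Henstock_Kurzweil_Integration.integral_combine[of 0 N M ?g] integrable_continuous_interval[OF c[of 0 M]] assms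
    by simp
  then have "norm (laplace_upto M f s - laplace_upto N f s) = norm (integral {N..M} ?g)" by simp
  also have "\<dots> \<le> C * (exp (- (b - a) * N) - exp (- (b - a) * M)) / (b - a)"
  proof (rule norm_integral_le_exp)
    fix x assume x: "x \<in> {N..M}"
    have "norm (?g x) \<le> exp (- Re s * x) * (C * exp (a * x))"
      using bound[of x] x assms by (simp add: norm_mult)
    also have "\<dots> \<le> exp (- b * x) * (C * exp (a * x))"
      using x assms C by (intro mult_right_mono) (auto intro: mult_right_mono)
    also have "\<dots> = C * exp (- (b - a) * x)" by (simp add: exp_add[symmetric] algebra_simps)
    finally show "norm (?g x) \<le> C * exp (- (b - a) * x)" .
  qed (use assms c in auto)
  also have "\<dots> \<le> C * exp (- (b - a) * N) / (b - a)"
    using C assms by (intro divide_right_mono mult_left_mono) auto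
  finally show ?thesis .
qed

lemma laplace_transform_exists:
  assumes f: "continuous_on {0..} f"
    and bound: "\<And>a. a > 0 \<Longrightarrow> \<exists>C. \<forall>x\<ge>0. norm (f x) \<le> C * exp (a * x)"
  obtains F where "F holomorphic_on {s. Re s > 0}"
    "\<And>s. Re s > 0 \<Longrightarrow> (\<lambda>n. laplace_upto (real n) f s) \<longlonglongrightarrow> F s"
proof -
  define F where "F s = lim (\<lambda>n. laplace_upto (real n) f s)" for s
  have U: "uniform_limit {s. Re s \<ge> b} (\<lambda>n. laplace_upto (real n) f) F sequentially" if b: "b > 0" for b
  proof -
    obtain C where C: "\<And>x. x \<ge> 0 \<Longrightarrow> norm (f x) \<le> C * exp (b / 2 * x)"
      using bound[of "b / 2"] b by auto
    have "((\<lambda>N. C * exp (- (b - b / 2) * real N) / (b - b / 2)) \<longlongrightarrow> 0) sequentially"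
      using b by real_asymp
    have "uniformly_Cauchy_on {s. Re s \<ge> b} (\<lambda>n. laplace_upto (real n) f)"
    proof (rule uniformly_Cauchy_onI')
      fix e :: real assume "e > 0"
      with \<open>((\<lambda>N. C * exp (- (b - b / 2) * real N) / (b - b / 2)) \<longlongrightarrow> 0) sequentially\<close>
      have "eventually (\<lambda>N. C * exp (- (b - b / 2) * real N) / (b - b / 2) < e) sequentially"
        by (rule order_tendstoD)
      then obtain M where M: "\<And>N. N \<ge> M \<Longrightarrow> C * exp (- (b - b / 2) * real N) / (b - b / 2) < e"
        by (auto simp: eventually_sequentially)
      have "dist (laplace_upto (real m) f s) (laplace_upto (real n) f s) < e"
        if "Re s \<ge> b" "m \<ge> M" "n > m" for s m n
        using laplace_upto_diff[OF f _ _ C, of m n b s] M[OF that(2)] that b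
        by (simp add: dist_norm norm_minus_commute)
      then show "\<exists>M. \<forall>s\<in>{s. Re s \<ge> b}. \<forall>m\<ge>M. \<forall>n>m.
          dist (laplace_upto (real m) f s) (laplace_upto (real n) f s) < e" by auto
    qed
    then have "uniformly_convergent_on {s. Re s \<ge> b} (\<lambda>n. laplace_upto (real n) f)"
      by (rule Cauchy_uniformly_convergent)
    then show ?thesis by (simp add: uniformly_convergent_uniform_limit_iff F_def[abs_def])
  qed
  show thesis
  proof (rule that)
    show "F holomorphic_on {s. Re s > 0}"
    proof (rule holomorphic_uniform_sequence)
      show "open {s. Re s > 0}" by (rule open_halfspace_Re_gt)
      show "laplace_upto (real n) f holomorphic_on {s. Re s > 0}" for n
        by (rule holomorphic_on_subset[OF laplace_upto_holomorphic[OF continuous_on_subset[OF f]]]) auto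
      fix z :: complex assume z: "z \<in> {s. Re s > 0}"
      have sub: "cball z (Re z / 2) \<subseteq> {s. Re s \<ge> Re z / 2}"
      proof
        fix s assume "s \<in> cball z (Re z / 2)"
        then have "Re (z - s) \<le> Re z / 2"
          using complex_Re_le_cmod[of "z - s"] by (simp add: dist_norm)
        then show "s \<in> {s. Re s \<ge> Re z / 2}" by simp
      qed
      moreover have "{s. Re s \<ge> Re z / 2} \<subseteq> {s. Re s > 0}" using z by auto
      ultimately show "\<exists>d>0. cball z d \<subseteq> {s. Re s > 0} \<and>
          uniform_limit (cball z d) (\<lambda>n. laplace_upto (real n) f) F sequentially"
        using z uniform_limit_on_subset[OF U sub] by (intro exI[of _ "Re z / 2"]) auto
    qed
    show "(\<lambda>n. laplace_upto (real n) f s) \<longlonglongrightarrow> F s" if "Re s > 0" for s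
      by (rule tendsto_uniform_limitI[OF U[OF that]]) simp
  qed
qed

text \<open>It suffices that every integral of f over [0,N] vanishes. This integral is the truncated
  transform at s = 0, far from the half-plane of the hypothesis, and an entire function connects the
  two.\<close>

lemma laplace_unique:
  assumes f: "continuous_on {0..} f"
    and bound: "\<And>x. x \<ge> 0 \<Longrightarrow> norm (f x) \<le> C * exp (a * x)" and ab: "a < b"
    and lim: "\<And>s. Re s \<ge> b \<Longrightarrow> (\<lambda>n. laplace_upto (real n) f s) \<longlonglongrightarrow> 0"
    and x: "x \<ge> 0"
  shows "f x = 0"
proof -
  have C: "C \<ge> 0" using order_trans[OF norm_ge_zero bound[of 0]] by simp
  have zero: "integral {0..N} f = 0" if N: "N \<ge> 0" for N
  proof -
    (* E is entire; it is bounded on every left half-plane trivially and on Re s >= b because there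
       E s = - exp (s * N) * integral {N..} (\<lambda>x. exp (- s * x) * f x). By Liouville it is constant. *)
    define E where "E s = exp (s * of_real N) * laplace_upto N f s" for s
    have fN: "continuous_on {0..N} f" by (rule continuous_on_subset[OF f]) auto
    define B where "B = C * exp (\<bar>a\<bar> * N)"
    have B: "norm (f x) \<le> B" if "x \<in> {0..N}" for x
    proof -
      have "a * x \<le> \<bar>a\<bar> * N" using that by (intro mult_mono) auto
      then have "C * exp (a * x) \<le> B" using C by (simp add: B_def mult_left_mono)
      with bound[of x] that show ?thesis by auto
    qed
    have "B \<ge> 0" using C by (simp add: B_def)
    have left: "norm (E s) \<le> B * (exp (c * N) - 1) / c" if s: "Re s \<le> c" "c \<noteq> 0" for s c
    proof -
      have "E s = integral {0..N} (\<lambda>x. exp (s * of_real N) * (exp (- s * of_real x) * f x))"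
        by (simp add: E_def laplace_upto_def)
      also have "norm \<dots> \<le> (B * exp (c * N)) * (exp (- c * 0) - exp (- c * N)) / c"
      proof (rule norm_integral_le_exp)
        fix x assume x: "x \<in> {0..N}"
        have "norm (exp (s * of_real N) * (exp (- s * of_real x) * f x)) = exp (Re s * (N - x)) * norm (f x)"
          by (simp add: norm_mult exp_add[symmetric] algebra_simps flip: mult.assoc)
        also have "\<dots> \<le> exp (c * (N - x)) * B"
          using x s B[OF x] by (intro mult_mono) (auto intro: mult_right_mono)
        also have "\<dots> = B * exp (c * N) * exp (- c * x)" by (simp add: exp_add[symmetric] algebra_simps)
        finally show "norm (exp (s * of_real N) * (exp (- s * of_real x) * f x)) \<le> B * exp (c * N) * exp (- c * x)" .
      qed (use N s in \<open>auto intro!: continuous_intros fN\<close>)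
      also have "\<dots> = B * (exp (c * N) - 1) / c" by (simp add: exp_minus right_diff_distrib)
      finally show ?thesis .
    qed
    have right: "norm (E s) \<le> C * exp (a * N) / (b - a)" if s: "Re s \<ge> b" for s
    proof -
      have "(\<lambda>n. norm (laplace_upto (real n) f s - laplace_upto N f s)) \<longlonglongrightarrow> norm (0 - laplace_upto N f s)"
        by (intro tendsto_intros lim s)
      \<comment> \<open>Taking Re s itself as abscissa in the tail estimate lets its decay cancel
        the growth of exp(s N) up to a constant.\<close>
      moreover have "eventually (\<lambda>n. norm (laplace_upto (real n) f s - laplace_upto N f s)
          \<le> C * exp (- (Re s - a) * N) / (Re s - a)) sequentially"
        using filterlim_real_sequentially[unfolded filterlim_at_top, rule_format, of N]
      proof eventually_elim
        case (elim n)
        then show ?case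
          by (intro laplace_upto_diff[OF f N]) (use bound ab s in auto)
      qed
      ultimately have "norm (0 - laplace_upto N f s) \<le> C * exp (- (Re s - a) * N) / (Re s - a)"
        by (rule tendsto_upperbound) simp
      then have "exp (Re s * N) * norm (laplace_upto N f s) \<le> exp (Re s * N) * (C * exp (- (Re s - a) * N) / (Re s - a))"
        by (intro mult_left_mono) auto
      also have "\<dots> = C * exp (a * N) / (Re s - a)"
        by (simp add: exp_add[symmetric] algebra_simps)
      also have "\<dots> \<le> C * exp (a * N) / (b - a)"
        using C ab s by (intro divide_left_mono) auto
      finally show ?thesis by (simp add: E_def norm_mult)
    qed
    have "E holomorphic_on UNIV"
      unfolding E_def by (intro holomorphic_intros laplace_upto_holomorphic fN)
    moreover have "bounded (range E)"
    proof -
      \<comment> \<open>Positive and at least \<open>b\<close>, so that the half-planes Re s \<le> c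
        and Re s \<ge> b cover the plane.\<close>
      define c where "c = \<bar>b\<bar> + 1"
      have "norm (E s) \<le> max (B * (exp (c * N) - 1) / c) (C * exp (a * N) / (b - a))" for s
        using left[of s c] right[of s] by (cases "Re s \<le> c") (auto simp: c_def le_max_iff_disj)
      then show ?thesis by (auto simp: bounded_iff)
    qed
    ultimately obtain k where k: "\<And>s. E s = k"
      using Liouville_theorem[of E] by (auto simp: constant_on_def)
    \<comment> \<open>The constant is 0 because E tends to 0 along the negative axis.\<close>
    have "((\<lambda>r. B / r) \<longlongrightarrow> 0) at_top" by real_asymp
    moreover have "eventually (\<lambda>r. norm k \<le> B / r) at_top"
      using eventually_gt_at_top[of 0]
    proof eventually_elim
      case (elim r)
      have "norm k \<le> B * (1 - exp (- r * N)) / r"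
        using left[of "- of_real r" "- r"] k elim by (simp add: algebra_simps minus_divide_left)
      also have "\<dots> \<le> B / r"
        using elim \<open>B \<ge> 0\<close> by (intro divide_right_mono) (auto simp: mult_left_le)
      finally show ?case .
    qed
    ultimately have "norm k \<le> 0" by (rule tendsto_lowerbound) simp
    then have "E 0 = 0" using k by simp
    then show ?thesis by (simp add: E_def laplace_upto_def)
  qed
  \<comment> \<open>The endpoint x + 1 keeps the interval nondegenerate when x = 0.\<close>
  have "((\<lambda>u. integral {0..u} f) has_vector_derivative f x) (at x within {0..x + 1})"
    by (rule integral_has_vector_derivative) (use x in \<open>auto intro: continuous_on_subset[OF f]\<close>)
  moreover have "((\<lambda>u. integral {0..u} f) has_vector_derivative 0) (at x within {0..x + 1})"
    by (rule has_vector_derivative_transform[OF _ _ has_vector_derivative_const]) (use x zero in auto)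
  ultimately show ?thesis
    using vector_derivative_unique_within_closed_interval[of 0 "x + 1" x] x by auto
qed

section \<open>Evolution of the transform in t and its growth in s\<close>

text \<open>Truncated form of s * dF_t/dt = F_t. The only defect is the boundary term at x = N from
  integration by parts, and Re s > 0 keeps |exp(-t/s)| \<le> 1, so this term is not
  amplified.\<close>

lemma laplace_upto_evolution:
  fixes v :: "real \<Rightarrow> real \<Rightarrow> complex"
  assumes cont: "continuous_on ({0..} \<times> {0..}) (\<lambda>(x, t). v x t)"
    and eq: "\<And>x t. x \<ge> 0 \<Longrightarrow> t \<ge> 0 \<Longrightarrow>
      v x t = v x 0 + integral {0..x} (\<lambda>\<xi>. integral {0..t} (v \<xi>))"
    and s: "Re s > 0" and NT: "N \<ge> 0" "T \<ge> 0"
    and bound: "\<And>t. t \<in> {0..T} \<Longrightarrow> norm (v N t) \<le> B"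
  shows "norm (exp (- of_real T / s) * laplace_upto N (\<lambda>x. v x T) s - laplace_upto N (\<lambda>x. v x 0) s)
    \<le> 2 * B * exp (- Re s * N) * (T / (norm s)\<^sup>2 + 1 / norm s)"
proof -
  define L where "L t = laplace_upto N (\<lambda>x. v x t) s" for t
  define q where "q t = v N t - v N 0" for t
  define e where "e x = exp (- s * of_real x)" for x :: real
  have s0: "s \<noteq> 0" using s by auto
  have cv: "continuous_on S (\<lambda>z. v (f z) (g z))"
    if "continuous_on S f" "continuous_on S g" "\<And>z. z \<in> S \<Longrightarrow> f z \<ge> 0 \<and> g z \<ge> 0"
    for S :: "'a::topological_space set" and f g
    using continuous_on_compose2[OF cont continuous_on_Pair[OF that(1,2)]] that(3) by fastforce
  have ce: "continuous_on S (\<lambda>z. e (f z))" if "continuous_on S f" for S :: "'a::topological_space set" and f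
    unfolding e_def by (intro continuous_intros that)
  have L_cont: "continuous_on {0..T} L"
  proof -
    have "continuous_on ({0..T} \<times> cbox 0 N) (\<lambda>(t, x). e x * v x t)"
      unfolding split_beta by (intro continuous_intros cv ce) auto
    from integral_continuous_on_param[OF this] show ?thesis
      by (simp add: L_def[abs_def] laplace_upto_def e_def)
  qed
  \<comment> \<open>Integration by parts in x of exp(-s x) against the primitive of
    \<open>h\<close>, followed by exchanging the order of integration.\<close>
  have parts: "e N * q t = integral {0..t} L - s * (L t - L 0)" if t: "t \<in> {0..T}" for t
  proof -
    define h where "h x = integral {0..t} (v x)" for x
    have "continuous_on ({0..N} \<times> cbox 0 t) (\<lambda>(x, \<tau>). v x \<tau>)"
      unfolding split_beta by (intro continuous_intros cv) auto
    from integral_continuous_on_param[OF this]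
    have h: "continuous_on {0..N} h" by (simp add: h_def[abs_def])
    have h_int: "integral {0..x} h = v x t - v x 0" if "x \<ge> 0" for x
      using eq[OF that, of t] t by (simp add: h_def[abs_def])
    have cL: "continuous_on {0..N} (\<lambda>x. e x * v x \<tau>)" if "\<tau> \<ge> 0" for \<tau>
      by (intro continuous_intros cv ce) (use that in auto)
    have "((\<lambda>x. e x * integral {0..x} h) has_vector_derivative
        e x * h x + - s * e x * integral {0..x} h) (at x within {0..N})" if "x \<in> {0..N}" for x
      using h that unfolding e_def
      by (intro has_vector_derivative_mult integral_has_vector_derivative)
        (auto intro!: derivative_eq_intros has_vector_derivative_real_field)
    then have "((\<lambda>x. e x * h x + - s * e x * integral {0..x} h) has_integral
        e N * integral {0..N} h - e 0 * integral {0..0} h) {0..N}"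
      using NT by (intro fundamental_theorem_of_calculus)
    then have "((\<lambda>x. e x * h x + - s * e x * integral {0..x} h) has_integral e N * q t) {0..N}"
      using h_int[of N] NT by (simp add: q_def)
    moreover have "((\<lambda>x. e x * h x) has_integral integral {0..t} L) {0..N}"
    proof -
      have "((\<lambda>x. e x * h x) has_integral integral {0..N} (\<lambda>x. e x * h x)) {0..N}"
        by (intro integrable_integral integrable_continuous_interval continuous_intros h ce)
      also have "integral {0..N} (\<lambda>x. e x * h x) = integral (cbox 0 N) (\<lambda>x. integral (cbox 0 t) (\<lambda>\<tau>. e x * v x \<tau>))"
        by (simp add: h_def)
      also have "\<dots> = integral (cbox 0 t) (\<lambda>\<tau>. integral (cbox 0 N) (\<lambda>x. e x * v x \<tau>))"
      proof (rule integral_swap_continuous)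
        show "continuous_on (cbox (0, 0) (N, t)) (\<lambda>(x, \<tau>). e x * v x \<tau>)"
          unfolding split_beta by (intro continuous_intros cv ce) (auto simp: cbox_Pair_eq)
      qed
      also have "\<dots> = integral {0..t} L" by (simp add: L_def[abs_def] laplace_upto_def e_def)
      finally show ?thesis .
    qed
    moreover have "((\<lambda>x. - s * (e x * v x t - e x * v x 0)) has_integral - s * (L t - L 0)) {0..N}"
      unfolding L_def laplace_upto_def e_def[symmetric]
      by (intro has_integral_mult_right has_integral_diff integrable_integral integrable_continuous_interval cL)
        (use t in auto)
    then have "((\<lambda>x. - s * e x * integral {0..x} h) has_integral - s * (L t - L 0)) {0..N}"
      by (rule has_integral_eq[rotated]) (simp add: h_int algebra_simps)
    ultimately have "((\<lambda>x. e x * h x + - s * e x * integral {0..x} h) has_integral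
        integral {0..t} L + - s * (L t - L 0)) {0..N}"
      by (intro has_integral_add)
    then show ?thesis
      using has_integral_unique[OF \<open>((\<lambda>x. e x * h x + - s * e x * integral {0..x} h) has_integral e N * q t) {0..N}\<close>] by simp
  qed

  \<comment> \<open>\<open>L\<close> is only known to be continuous. \<open>U\<close>, built from
    its integral, is differentiable, differs from \<open>L\<close> by the boundary term divided by
    s, and admits the integrating factor exp(-t/s). The integrated error gives the term T / |s|^2 of
    the conclusion, the return from \<open>U\<close> to \<open>L\<close> the term 1 / |s|.\<close>
  define U where "U t = L 0 + integral {0..t} L / s" for t
  have U_eq: "U t = L t + e N * q t / s" if "t \<in> {0..T}" for t
    unfolding parts[OF that] U_def using s0 by (simp add: field_simps)
  define Y' where "Y' t = - (exp (- of_real t / s) * (e N * q t) / s\<^sup>2)" for t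
  have "((\<lambda>t. exp (- of_real t / s) * U t) has_vector_derivative Y' t) (at t within {0..T})" if t: "t \<in> {0..T}" for t
  proof -
    have "((\<lambda>t. integral {0..t} L) has_vector_derivative L t) (at t within {0..T})"
      by (rule integral_has_vector_derivative[OF L_cont t])
    then have "(U has_vector_derivative L t / s) (at t within {0..T})"
      unfolding U_def by (auto intro!: derivative_eq_intros)
    then have "((\<lambda>t. exp (- of_real t / s) * U t) has_vector_derivative
        exp (- of_real t / s) * (L t / s) + - (1 / s) * exp (- of_real t / s) * U t) (at t within {0..T})"
      using s0 by (intro has_vector_derivative_mult)
        (auto intro!: derivative_eq_intros has_vector_derivative_real_field)
    moreover have "exp (- of_real t / s) * (L t / s) + - (1 / s) * exp (- of_real t / s) * U t = Y' t"
      unfolding U_eq[OF t] Y'_def using s0 by (simp add: field_simps power2_eq_square)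
    ultimately show ?thesis by simp
  qed
  then have I: "(Y' has_integral exp (- of_real T / s) * U T - exp (- of_real 0 / s) * U 0) (cbox 0 T)"
    using NT unfolding cbox_interval by (intro fundamental_theorem_of_calculus)
  have q: "norm (e N * q t) \<le> 2 * B * exp (- Re s * N)" if "t \<in> {0..T}" for t
  proof -
    have "norm (q t) \<le> norm (v N t) + norm (v N 0)" unfolding q_def by (rule norm_triangle_ineq4)
    also have "\<dots> \<le> 2 * B" using bound[OF that] bound[of 0] NT by simp
    finally have "exp (- Re s * N) * norm (q t) \<le> exp (- Re s * N) * (2 * B)" by (intro mult_left_mono) auto
    then show ?thesis by (simp add: e_def norm_mult mult.commute)
  qed
  have "B \<ge> 0" using order_trans[OF norm_ge_zero bound[of 0]] NT by simp
  have "norm (exp (- of_real T / s) * U T - exp (- of_real 0 / s) * U 0)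
      \<le> (2 * B * exp (- Re s * N) / (norm s)\<^sup>2) * measure lborel (cbox 0 T)"
  proof (rule has_integral_bound[OF _ I])
    fix t assume t: "t \<in> cbox 0 T"
    have "norm (exp (- of_real t / s)) \<le> 1"
      using t s by (simp add: Re_divide complex_eq_iff divide_nonneg_nonneg)
    then have "norm (exp (- of_real t / s)) * norm (e N * q t) \<le> 1 * (2 * B * exp (- Re s * N))"
      using q[of t] t by (intro mult_mono) auto
    then show "norm (Y' t) \<le> 2 * B * exp (- Re s * N) / (norm s)\<^sup>2"
      unfolding Y'_def norm_minus_cancel norm_divide norm_mult norm_power
      by (intro divide_right_mono) (auto simp: norm_mult)
  qed (use \<open>B \<ge> 0\<close> in auto)
  then have 1: "norm (exp (- of_real T / s) * U T - L 0) \<le> 2 * B * exp (- Re s * N) * (T / (norm s)\<^sup>2)"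
    using NT by (simp add: U_def)
  have "exp (- of_real T / s) * L T - L 0
      = (exp (- of_real T / s) * U T - L 0) - exp (- of_real T / s) * (e N * q T / s)"
    using U_eq[of T] NT by (simp add: algebra_simps)
  also have "norm \<dots> \<le> norm (exp (- of_real T / s) * U T - L 0) + norm (exp (- of_real T / s) * (e N * q T / s))"
    by (rule norm_triangle_ineq4)
  also have "norm (exp (- of_real T / s) * (e N * q T / s)) \<le> 1 * (2 * B * exp (- Re s * N) / norm s)"
  proof -
    have "norm (exp (- of_real T / s)) \<le> 1"
      using NT s by (simp add: Re_divide complex_eq_iff divide_nonneg_nonneg)
    moreover have "norm (e N * q T / s) \<le> 2 * B * exp (- Re s * N) / norm s"
      unfolding norm_divide using q[of T] NT by (intro divide_right_mono) auto
    ultimately show ?thesis unfolding norm_mult[of "exp _"] by (rule mult_mono) auto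
  qed
  finally show ?thesis using 1 by (simp add: L_def algebra_simps)
qed

text \<open>A constant \<mu> strictly between \<theta>^2/4 and \<kappa> leaves part of the decay
  exp(-x Re s) for the integration. This costs a factor 1 / Re s, absorbed by exp((\<kappa> - \<mu>)
  / Re s). The constant \<open>K\<close> depends on none of f, A, N, s.\<close>

lemma laplace_upto_bound:
  assumes \<theta>: "\<theta> > 0" "\<kappa> > \<theta>\<^sup>2 / 4"
  obtains K where "K > 0"
    "\<And>f A N s. continuous_on {0..N} f \<Longrightarrow> N \<ge> 0 \<Longrightarrow> Re s > 0 \<Longrightarrow> A \<ge> 0 \<Longrightarrow>
      (\<And>x. x \<in> {0..N} \<Longrightarrow> norm (f x) \<le> A * exp (\<theta> * sqrt x)) \<Longrightarrow>
      norm (laplace_upto N f s) \<le> A * K * exp (\<kappa> / Re s)"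
proof -
  define \<mu> where "\<mu> = (\<kappa> + \<theta>\<^sup>2 / 4) / 2"
  have \<mu>: "\<theta>\<^sup>2 / 4 < \<mu>" "\<mu> < \<kappa>" "\<mu> > 0"
    unfolding \<mu>_def using \<theta> zero_le_power2[of \<theta>] by (simp_all only: field_simps)
  define \<eta> where "\<eta> = 1 - \<theta>\<^sup>2 / (4 * \<mu>)"
  have \<eta>: "\<eta> > 0" using \<mu> by (simp add: \<eta>_def field_simps)
  define K where "K = 1 / (\<eta> * (\<kappa> - \<mu>))"
  show thesis
  proof (rule that[of K])
    show "K > 0" using \<eta> \<mu> by (simp add: K_def)
    fix f :: "real \<Rightarrow> complex" and A N :: real and s :: complex
    assume f: "continuous_on {0..N} f" and N: "N \<ge> 0" and s: "Re s > 0" and A: "A \<ge> 0"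
      and bound: "\<And>x. x \<in> {0..N} \<Longrightarrow> norm (f x) \<le> A * exp (\<theta> * sqrt x)"
    let ?\<sigma> = "Re s"
    have exponent: "\<theta> * sqrt x - ?\<sigma> * x \<le> \<mu> / ?\<sigma> - \<eta> * ?\<sigma> * x" if "x \<ge> 0" for x
    proof -
      define r where "r = sqrt x"
      have x: "x = r\<^sup>2" using that by (simp add: r_def)
      \<comment> \<open>Completing the square in r = sqrt x.\<close>
      have "0 \<le> (\<theta> * ?\<sigma> * r - 2 * \<mu>)\<^sup>2 / (4 * \<mu> * ?\<sigma>)" using \<mu> s by simp
      also have "\<dots> = \<mu> / ?\<sigma> - \<eta> * ?\<sigma> * r\<^sup>2 - (\<theta> * r - ?\<sigma> * r\<^sup>2)"
        using \<mu> s by (simp add: \<eta>_def field_simps power2_eq_square)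
      finally show ?thesis by (simp add: x[symmetric] r_def[symmetric])
    qed
    have "norm (laplace_upto N f s) \<le>
        A * exp (\<mu> / ?\<sigma>) * (exp (- (\<eta> * ?\<sigma>) * 0) - exp (- (\<eta> * ?\<sigma>) * N)) / (\<eta> * ?\<sigma>)"
      unfolding laplace_upto_def
    proof (rule norm_integral_le_exp)
      fix x assume x: "x \<in> {0..N}"
      have "norm (exp (- s * of_real x) * f x) \<le> exp (- ?\<sigma> * x) * (A * exp (\<theta> * sqrt x))"
        using bound[OF x] by (simp add: norm_mult)
      also have "\<dots> = A * exp (\<theta> * sqrt x - ?\<sigma> * x)" by (simp add: exp_diff exp_minus field_simps)
      also have "\<dots> \<le> A * exp (\<mu> / ?\<sigma> - \<eta> * ?\<sigma> * x)"
        using exponent[of x] x A by (intro mult_left_mono) auto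
      also have "\<dots> = A * exp (\<mu> / ?\<sigma>) * exp (- (\<eta> * ?\<sigma>) * x)"
        by (simp add: exp_diff exp_minus field_simps)
      finally show "norm (exp (- s * of_real x) * f x) \<le> A * exp (\<mu> / ?\<sigma>) * exp (- (\<eta> * ?\<sigma>) * x)" .
    qed (use N \<eta> s in \<open>auto intro!: continuous_intros f\<close>)
    also have "\<dots> \<le> A * exp (\<mu> / ?\<sigma>) * 1 / (\<eta> * ?\<sigma>)"
      using A \<eta> s by (intro divide_right_mono mult_left_mono) auto
    also have "\<dots> = A * exp (\<mu> / ?\<sigma>) * K * ((\<kappa> - \<mu>) / ?\<sigma>)"
    proof -
      have "K * ((\<kappa> - \<mu>) / ?\<sigma>) = 1 / (\<eta> * ?\<sigma>)" using \<mu> by (simp add: K_def)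
      then show ?thesis by (simp only: mult.assoc) simp
    qed
    also have "\<dots> \<le> A * exp (\<mu> / ?\<sigma>) * K * exp ((\<kappa> - \<mu>) / ?\<sigma>)"
    proof (rule mult_left_mono)
      show "(\<kappa> - \<mu>) / ?\<sigma> \<le> exp ((\<kappa> - \<mu>) / ?\<sigma>)"
        using exp_ge_add_one_self[of "(\<kappa> - \<mu>) / ?\<sigma>"] by linarith
    qed (use A \<open>K > 0\<close> in auto)
    also have "\<dots> = A * K * exp (\<kappa> / ?\<sigma>)"
      by (simp add: exp_add[symmetric] diff_divide_distrib mult_ac)
    finally show "norm (laplace_upto N f s) \<le> A * K * exp (\<kappa> / ?\<sigma>)" .
  qed
qed

section \<open>The Goursat problem\<close>

text \<open>Makes the growth in x smaller than exp(a x) for every a > 0, so that the transforms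
  exist on the whole right half-plane.\<close>

lemma sqrt_le_linear:
  fixes \<theta> a x :: real
  assumes "a > 0" "x \<ge> 0" shows "\<theta> * sqrt x \<le> \<theta>\<^sup>2 / (4 * a) + a * x"
proof -
  have "0 \<le> (\<theta> - 2 * a * sqrt x)\<^sup>2 / (4 * a)" using assms by simp
  also have "\<dots> = \<theta>\<^sup>2 / (4 * a) + a * x - \<theta> * sqrt x"
    using assms by (simp add: power2_diff power_mult_distrib field_simps power2_eq_square)
  finally show ?thesis by simp
qed

text \<open>The condition on the edge x = 0 is encoded by the absence of a term v 0 t - v 0 0 from
  the integral equation.\<close>

lemma goursat_problem_zero:
  fixes v :: "real \<Rightarrow> real \<Rightarrow> complex"
  assumes cont: "continuous_on ({0..} \<times> {0..}) (\<lambda>(x, t). v x t)"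
    and eq: "\<And>x t. x \<ge> 0 \<Longrightarrow> t \<ge> 0 \<Longrightarrow>
      v x t = v x 0 + integral {0..x} (\<lambda>\<xi>. integral {0..t} (v \<xi>))"
    and \<theta>: "\<theta>\<^sub>1 > 0" "\<theta>\<^sub>2 > 0" "\<theta>\<^sub>1 * \<theta>\<^sub>2 < 2 * pi"
    and growth: "\<And>x t. x \<ge> 0 \<Longrightarrow> t \<ge> 0 \<Longrightarrow>
      norm (v x t) \<le> C * exp (\<theta>\<^sub>1 * sqrt x + exp (\<theta>\<^sub>2 * sqrt t))"
    and xt: "x \<ge> 0" "t \<ge> 0"
  shows "v x t = 0"
proof -
  have C: "C \<ge> 0"
    using order_trans[OF norm_ge_zero growth[of 0 0]] by (simp add: zero_le_mult_iff not_le)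
  have cont': "continuous_on {0..} (\<lambda>x. v x T)" if "T \<ge> 0" for T
  proof -
    have "continuous_on {0..} (\<lambda>x. (x, T))" by (intro continuous_intros)
    from continuous_on_compose2[OF cont this] that show ?thesis by auto
  qed
  have growth': "norm (v x T) \<le> C * exp (exp (\<theta>\<^sub>2 * sqrt T)) * exp (\<theta>\<^sub>1 * sqrt x)" if "x \<ge> 0" "T \<ge> 0" for x T
    using growth[OF that] by (simp add: exp_add mult_ac)
  have linear: "norm (v x T) \<le> C * exp (exp (\<theta>\<^sub>2 * sqrt T)) * exp (\<theta>\<^sub>1\<^sup>2 / (4 * a)) * exp (a * x)"
    if "a > 0" "x \<ge> 0" "T \<ge> 0" for a x T
  proof -
    have "C * exp (exp (\<theta>\<^sub>2 * sqrt T)) * exp (\<theta>\<^sub>1 * sqrt x)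
        \<le> C * exp (exp (\<theta>\<^sub>2 * sqrt T)) * exp (\<theta>\<^sub>1\<^sup>2 / (4 * a) + a * x)"
      using C sqrt_le_linear[OF that(1,2)] by (intro mult_left_mono) auto
    with growth'[OF that(2,3)] show ?thesis by (simp add: exp_add mult_ac)
  qed

  obtain F where F: "F holomorphic_on {s. Re s > 0}"
    and F_lim: "\<And>s. Re s > 0 \<Longrightarrow> (\<lambda>n. laplace_upto (real n) (\<lambda>x. v x 0) s) \<longlonglongrightarrow> F s"
    using laplace_transform_exists[OF cont'[of 0]] linear[of _ _ 0] by (metis order_refl)
  \<comment> \<open>The truncation error is of order exp(\<open>\<theta>\<^sub>1 * sqrt n\<close> -
    n Re s), which tends to 0.\<close>
  have lim: "(\<lambda>n. laplace_upto (real n) (\<lambda>x. v x T) s) \<longlonglongrightarrow> exp (of_real T / s) * F s"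
    if s: "Re s > 0" and T: "T \<ge> 0" for s T
  proof -
    define B where "B n = C * exp (exp (\<theta>\<^sub>2 * sqrt T)) * exp (\<theta>\<^sub>1 * sqrt (real n))" for n
    let ?D = "\<lambda>n. exp (- of_real T / s) * laplace_upto (real n) (\<lambda>x. v x T) s - laplace_upto (real n) (\<lambda>x. v x 0) s"
    have "norm (?D n) \<le> 2 * B n * exp (- Re s * real n) * (T / (norm s)\<^sup>2 + 1 / norm s)" for n
    proof (rule laplace_upto_evolution[OF cont eq s _ T])
      fix t assume t: "t \<in> {0..T}"
      have "norm (v (real n) t) \<le> C * exp (exp (\<theta>\<^sub>2 * sqrt t)) * exp (\<theta>\<^sub>1 * sqrt (real n))"
        using growth'[of "real n" t] t by simp
      also have "\<dots> \<le> B n"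
        unfolding B_def using t C \<theta> by (intro mult_right_mono mult_left_mono) auto
      finally show "norm (v (real n) t) \<le> B n" .
    qed auto
    moreover have "(\<lambda>n. 2 * B n * exp (- Re s * real n) * (T / (norm s)\<^sup>2 + 1 / norm s)) \<longlonglongrightarrow> 0"
      unfolding B_def using s \<theta> by real_asymp
    ultimately have "?D \<longlonglongrightarrow> 0"
      by (rule Lim_null_comparison[OF always_eventually[OF allI]])
    from tendsto_add[OF this F_lim[OF s]]
    have "(\<lambda>n. exp (- of_real T / s) * laplace_upto (real n) (\<lambda>x. v x T) s) \<longlonglongrightarrow> F s" by simp
    from tendsto_mult_left[OF this, of "exp (of_real T / s)"] show ?thesis
      by (simp add: exp_minus flip: mult.assoc)
  qed

  \<comment> \<open>The midpoint between what \<open>laplace_upto_bound\<close> needs from below and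
    \<open>holomorphic_right_half_plane_zero\<close> from above; the gap is open because
    \<open>\<theta>\<^sub>1 * \<theta>\<^sub>2 < 2 * pi\<close>.\<close>
  define \<kappa> where "\<kappa> = (\<theta>\<^sub>1\<^sup>2 / 4 + pi\<^sup>2 / \<theta>\<^sub>2\<^sup>2) / 2"
  have "(\<theta>\<^sub>1 * \<theta>\<^sub>2)\<^sup>2 < (2 * pi)\<^sup>2" using \<theta> by (intro power_strict_mono) auto
  then have "\<theta>\<^sub>1\<^sup>2 / 4 < pi\<^sup>2 / \<theta>\<^sub>2\<^sup>2"
    using \<theta> by (simp add: power_mult_distrib field_simps)
  moreover have "a < (a + b) / 2 \<and> (a + b) / 2 < b" if "a < b" for a b :: real
    using that by simp
  ultimately have \<kappa>: "\<theta>\<^sub>1\<^sup>2 / 4 < \<kappa>" "\<kappa> < pi\<^sup>2 / \<theta>\<^sub>2\<^sup>2"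
    unfolding \<kappa>_def by blast+
  then have \<kappa>': "\<kappa> > 0" "\<kappa> * \<theta>\<^sub>2\<^sup>2 < pi\<^sup>2"
    using \<theta> zero_le_power2[of "\<theta>\<^sub>1"] by (linarith, simp add: field_simps)
  obtain K where K: "K > 0"
    "\<And>f A N s. continuous_on {0..N} f \<Longrightarrow> N \<ge> 0 \<Longrightarrow> Re s > 0 \<Longrightarrow> A \<ge> 0 \<Longrightarrow>
      (\<And>x. x \<in> {0..N} \<Longrightarrow> norm (f x) \<le> A * exp (\<theta>\<^sub>1 * sqrt x)) \<Longrightarrow>
      norm (laplace_upto N f s) \<le> A * K * exp (\<kappa> / Re s)"
    using laplace_upto_bound[OF \<theta>(1) \<kappa>(1)] by blast
  have F_bound: "norm (exp (of_real T / s) * F s) \<le> C * exp (exp (\<theta>\<^sub>2 * sqrt T)) * K * exp (\<kappa> / Re s)"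
    if s: "Re s > 0" and T: "T \<ge> 0" for s T
  proof (rule tendsto_upperbound[OF tendsto_norm[OF lim[OF that]]])
    have "norm (laplace_upto (real n) (\<lambda>x. v x T) s) \<le> C * exp (exp (\<theta>\<^sub>2 * sqrt T)) * K * exp (\<kappa> / Re s)" for n
      by (rule K(2)) (use s C growth' T in \<open>auto intro: continuous_on_subset[OF cont'[OF T]]\<close>)
    then show "\<forall>\<^sub>F n in sequentially. norm (laplace_upto (real n) (\<lambda>x. v x T) s)
        \<le> C * exp (exp (\<theta>\<^sub>2 * sqrt T)) * K * exp (\<kappa> / Re s)" by simp
  qed simp

  have Re_inv: "Re (1 / w) > 0" if "Re w > 0" for w :: complex
  proof -
    have "w \<noteq> 0" using that by auto
    then show ?thesis using that by (simp add: Re_divide cmod_power2[symmetric])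
  qed
  have G0: "F (1 / w) = 0" if "Re w > 0" for w
  proof (rule holomorphic_right_half_plane_zero[OF _ \<kappa>'(1) \<theta>(2) \<kappa>'(2) _ that])
    have "(\<lambda>w. 1 / w) holomorphic_on {w. Re w > 0}" by (intro holomorphic_intros) auto
    then show "(\<lambda>w. F (1 / w)) holomorphic_on {w. Re w > 0}"
      by (rule holomorphic_on_compose_gen[OF _ F, unfolded o_def]) (use Re_inv in auto)
    fix w T assume w: "Re w > 0" and T: "T \<ge> (0::real)"
    have w0: "w \<noteq> 0" using w by auto
    have "1 / Re (1 / w) = (norm w)\<^sup>2 / Re w"
      using w w0 by (simp add: Re_divide cmod_power2)
    then have *: "\<kappa> / Re (1 / w) = \<kappa> * (norm w)\<^sup>2 / Re w"
      by (metis times_divide_eq_right mult.right_neutral)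
    have "exp (T * Re w) * norm (F (1 / w)) \<le> C * exp (exp (\<theta>\<^sub>2 * sqrt T)) * K * exp (\<kappa> / Re (1 / w))"
      using F_bound[OF Re_inv[OF w] T] by (simp add: norm_mult)
    then have "exp (- T * Re w) * (exp (T * Re w) * norm (F (1 / w)))
        \<le> exp (- T * Re w) * (C * exp (exp (\<theta>\<^sub>2 * sqrt T)) * K * exp (\<kappa> / Re (1 / w)))"
      by (intro mult_left_mono) auto
    then show "norm (F (1 / w)) \<le> C * K * exp (- T * Re w + exp (\<theta>\<^sub>2 * sqrt T) + \<kappa> * (norm w)\<^sup>2 / Re w)"
      unfolding * by (simp add: mult.assoc[symmetric] exp_add exp_minus) (simp add: exp_diff divide_inverse mult_ac)
  qed
  have F0: "F s = 0" if "Re s > 0" for s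
    using G0[OF Re_inv[OF that]] by simp

  show ?thesis
  proof (rule laplace_unique[OF cont'[OF xt(2)] _ _ _ xt(1)])
    show "norm (v x t) \<le> C * exp (exp (\<theta>\<^sub>2 * sqrt t)) * exp (\<theta>\<^sub>1\<^sup>2 / (4 * 1)) * exp (1 * x)"
      if "x \<ge> 0" for x
      by (rule linear) (use that xt in auto)
    show "1 < (2::real)" by simp
    show "(\<lambda>n. laplace_upto (real n) (\<lambda>x. v x t) s) \<longlonglongrightarrow> 0" if "Re s \<ge> 2" for s
      using lim[of s t] F0[of s] that xt by simp
  qed
qed

theorem theorem1p22:
  fixes u :: "real \<times> real \<Rightarrow> complex" and \<theta>\<^sub>1 \<theta>\<^sub>2 :: real
  assumes "continuous_on ({0..} \<times> {..0}) u"
    and "klein_gordon_distr ({0<..} \<times> {..<0}) u"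
    and "\<And>y. y \<le> 0 \<Longrightarrow> u (0, y) = 0"
    and "\<theta>\<^sub>1 > 0" and "\<theta>\<^sub>2 > 0" and "\<theta>\<^sub>1 * \<theta>\<^sub>2 < 2 * pi"
    and "\<exists>C::real. \<forall>x\<ge>0. \<forall>y\<le>0.
           norm (u (x, y)) \<le> C * exp (\<theta>\<^sub>1 * sqrt \<bar>x\<bar> + exp (\<theta>\<^sub>2 * sqrt \<bar>y\<bar>))"
  shows "\<forall>x\<ge>0. \<forall>y\<le>0. u (x, y) = 0"
proof (intro allI impI)
  fix x y :: real assume xy: "x \<ge> 0" "y \<le> 0"
  obtain C where C: "\<And>x y. x \<ge> 0 \<Longrightarrow> y \<le> 0 \<Longrightarrow>
      norm (u (x, y)) \<le> C * exp (\<theta>\<^sub>1 * sqrt \<bar>x\<bar> + exp (\<theta>\<^sub>2 * sqrt \<bar>y\<bar>))"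
    using assms(7) by blast
  define v where "v x t = u (x, - t)" for x t
  have eq: "v x t = v x 0 + integral {0..x} (\<lambda>\<xi>. integral {0..t} (v \<xi>))" if "x \<ge> 0" "t \<ge> 0" for x t
  \<comment> \<open>Degenerate rectangles are outside \<open>klein_gordon_rectangle\<close>; there
    the double integral is 0, and for x = 0 the boundary condition gives the equation.\<close>
  proof (cases "x = 0 \<or> t = 0")
    case True
    then show ?thesis using assms(3) that by (auto simp: v_def)
  next
    case False
    with that have "x > 0" "t > 0" by auto
    have "u (x, - t) - u (x, 0) = integral (cbox (0, - t) (x, 0)) u"
      using klein_gordon_rectangle[OF assms(1,2) \<open>x > 0\<close> \<open>t > 0\<close>] assms(3) \<open>t > 0\<close> by simp
    also have "\<dots> = integral {0..x} (\<lambda>\<xi>. integral {- t..0} (\<lambda>y. u (\<xi>, y)))"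
      unfolding cbox_interval[symmetric]
      by (rule integral_prod_continuous, rule continuous_on_subset[OF assms(1)]) (auto simp: cbox_Pair_eq)
    also have "\<dots> = integral {0..x} (\<lambda>\<xi>. integral {0..t} (v \<xi>))"
      using Henstock_Kurzweil_Integration.integral_reflect_real[of t 0 "v \<xi>" for \<xi>]
      by (simp add: v_def)
    finally show ?thesis by (simp add: v_def algebra_simps)
  qed
  have "v x (- y) = 0"
  proof (rule goursat_problem_zero[OF _ eq assms(4-6)])
    show "continuous_on ({0..} \<times> {0..}) (\<lambda>(x, t). v x t)"
      unfolding v_def split_beta
      by (intro continuous_on_compose2[OF assms(1)] continuous_intros) auto
    show "norm (v x t) \<le> C * exp (\<theta>\<^sub>1 * sqrt x + exp (\<theta>\<^sub>2 * sqrt t))" if "x \<ge> 0" "t \<ge> 0" for x t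
      using C[of x "- t"] that by (simp add: v_def)
  qed (use xy in auto)
  then show "u (x, y) = 0" by (simp add: v_def)
qed

end
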